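(* Let $r\geq 0$. Every filtered dg-algebra has an $E_r$-minimal $A_\infty$-model.
   Context: Work over a field. A filtered dg-algebra $(A,d,\mu,F)$ is a dg-algebra with a decreasing, bounded below, exhaustive filtration $F$ with $d(F^pA^n)\subseteq F^pA^{n+1}$ and $\mu(F^pA\otimes F^qA)\subseteq F^{p+q}A$; $E_r(A)$ denotes the $r$-th page of its associated spectral sequence. An $E_r$-minimal $A_\infty$-model of $(A,d,F)$ is an $A_\infty$-algebra $(M,d,\nu_s)$ with a bigrading $M=\bigoplus M^{p,q}$ (with $M^n=\bigoplus_{p+q=n}M^{p,q}$, filtered by $F^pM^n=\bigoplus_{p'\ge p}M^{p',n-p'}$) such that $d(M^{p,q})\subseteq \bigoplus_{k\geq 0}M^{p+r+k+1,q-r-k}$ and, for all $s\geq 2$, $\nu_s(M^{p_1,q_1}\otimes\cdots\otimes M^{p_s,q_s})\subseteq \bigoplus_{k\geq 0}M^{p_1+\cdots+p_s+(2-s)r+k,\;q_1+\cdots+q_s+(2-s)(1-r)-k}$, together with a morphism of $A_\infty$-algebras $f=(f_s)_{s\ge1}:M\to A$ (where $A$ is viewed as an $A_\infty$-algebra with $\nu_2=\mu$, $\nu_s=0$ for $s\ge 3$) satisfying $f_s(M^{p_1,q_1}\otimes\cdots\otimes M^{p_s,q_s})\subseteq F^{p_1+\cdots+p_s+(1-s)r}A^{p_1+\cdots+p_s+q_1+\cdots+q_s-s+1}$ and such that $E_r(f_1):E_{r}(M)\to E_{r}(A)$ is a quasi-isomorphism of complexes. *)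

theory Defs
  imports Complex_Main
begin

text \<open>Conventions. A (graded) vector space over the field 'k is represented by a type 'a
with an abelian group structure and a scalar multiplication scale satisfying vector_space;
a grading is a family of subspaces G n (n :: int) forming a direct sum; the underlying
total space is their span.  Multilinear operations are functions on lists.
Sign conventions for A-infinity algebras and morphisms are those of Keller
(Introduction to A-infinity algebras and modules).\<close>

definition ksign :: "int \<Rightarrow> 'k::field" where
  "ksign e = (if even e then 1 else - 1)"

definition lin_on :: "('k::field \<Rightarrow> 'a::ab_group_add \<Rightarrow> 'a) \<Rightarrow> 'a set \<Rightarrow> ('a \<Rightarrow> 'a) \<Rightarrow> bool" where
  "lin_on scale S g \<longleftrightarrow> (\<forall>c x y. x \<in> S \<longrightarrow> y \<in> S \<longrightarrow> g (scale c x + y) = scale c (g x) + g y)"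

definition multilin_on :: "('k::field \<Rightarrow> 'a::ab_group_add \<Rightarrow> 'a) \<Rightarrow> 'a set \<Rightarrow> nat \<Rightarrow> ('a list \<Rightarrow> 'a) \<Rightarrow> bool" where
  "multilin_on scale S s h \<longleftrightarrow>
     (\<forall>xs. length xs = s \<longrightarrow> set xs \<subseteq> S \<longrightarrow> (\<forall>i<s. lin_on scale S (\<lambda>u. h (xs[i := u]))))"

definition direct_family :: "('i \<Rightarrow> 'a::ab_group_add set) \<Rightarrow> bool" where
  "direct_family G \<longleftrightarrow>
     (\<forall>I x. finite I \<longrightarrow> (\<forall>i\<in>I. x i \<in> G i) \<longrightarrow> sum x I = 0 \<longrightarrow> (\<forall>i\<in>I. x i = 0))"

definition graded_vs :: "('k::field \<Rightarrow> 'a::ab_group_add \<Rightarrow> 'a) \<Rightarrow> (int \<Rightarrow> 'a set) \<Rightarrow> bool" where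
  "graded_vs scale G \<longleftrightarrow> vector_space scale \<and> (\<forall>n. module.subspace scale (G n)) \<and> direct_family G"

definition tot :: "('k::field \<Rightarrow> 'a::ab_group_add \<Rightarrow> 'a) \<Rightarrow> (int \<Rightarrow> 'a set) \<Rightarrow> 'a set" where
  "tot scale G = module.span scale (\<Union>n. G n)"

definition homog :: "(int \<Rightarrow> 'a set) \<Rightarrow> int list \<Rightarrow> 'a list \<Rightarrow> bool" where
  "homog G ns xs \<longleftrightarrow> length xs = length ns \<and> (\<forall>i<length xs. xs ! i \<in> G (ns ! i))"

definition dga :: "('k::field \<Rightarrow> 'a::ab_group_add \<Rightarrow> 'a) \<Rightarrow> (int \<Rightarrow> 'a set) \<Rightarrow> ('a \<Rightarrow> 'a) \<Rightarrow> ('a \<Rightarrow> 'a \<Rightarrow> 'a) \<Rightarrow> bool" where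
  "dga scale G d mu \<longleftrightarrow>
     graded_vs scale G \<and>
     lin_on scale (tot scale G) d \<and>
     (\<forall>n x. x \<in> G n \<longrightarrow> d x \<in> G (n + 1)) \<and>
     (\<forall>x\<in>tot scale G. d (d x) = 0) \<and>
     (\<forall>x\<in>tot scale G. lin_on scale (tot scale G) (mu x)) \<and>
     (\<forall>y\<in>tot scale G. lin_on scale (tot scale G) (\<lambda>x. mu x y)) \<and>
     (\<forall>p q x y. x \<in> G p \<longrightarrow> y \<in> G q \<longrightarrow> mu x y \<in> G (p + q)) \<and>
     (\<forall>x\<in>tot scale G. \<forall>y\<in>tot scale G. \<forall>z\<in>tot scale G. mu (mu x y) z = mu x (mu y z)) \<and>
     (\<forall>p x y. x \<in> G p \<longrightarrow> y \<in> tot scale G \<longrightarrow>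
        d (mu x y) = mu (d x) y + scale (ksign p) (mu x (d y)))"

definition filtered_dga :: "('k::field \<Rightarrow> 'a::ab_group_add \<Rightarrow> 'a) \<Rightarrow> (int \<Rightarrow> 'a set) \<Rightarrow> ('a \<Rightarrow> 'a)
    \<Rightarrow> ('a \<Rightarrow> 'a \<Rightarrow> 'a) \<Rightarrow> (int \<Rightarrow> int \<Rightarrow> 'a set) \<Rightarrow> bool" where
  "filtered_dga scale G d mu F \<longleftrightarrow>
     dga scale G d mu \<and>
     (\<forall>p n. module.subspace scale (F p n) \<and> F p n \<subseteq> G n \<and> F (p + 1) n \<subseteq> F p n) \<and>
     (\<forall>n. \<exists>l. F l n = {0}) \<and>
     (\<forall>n. (\<Union>p. F p n) = G n) \<and>
     (\<forall>p n. d ` F p n \<subseteq> F p (n + 1)) \<and>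
     (\<forall>p q i j x y. x \<in> F p i \<longrightarrow> y \<in> F q j \<longrightarrow> mu x y \<in> F (p + q) (i + j))"

text \<open>E_r^{p,n} = Zr r p n / Nr r p n  (p = filtration degree, n = total degree),
  d_r [x] = [d x] : E_r^{p,n} \<rightarrow> E_r^{p+r,n+1}.\<close>
definition Zr :: "('a \<Rightarrow> 'a) \<Rightarrow> (int \<Rightarrow> int \<Rightarrow> 'a set) \<Rightarrow> int \<Rightarrow> int \<Rightarrow> int \<Rightarrow> 'a set" where
  "Zr d F r p n = {x \<in> F p n. d x \<in> F (p + r) (n + 1)}"

definition Nr :: "('a \<Rightarrow> 'a) \<Rightarrow> (int \<Rightarrow> int \<Rightarrow> 'a set) \<Rightarrow> int \<Rightarrow> int \<Rightarrow> int \<Rightarrow> 'a::ab_group_add set" where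
  "Nr d F r p n = {y + d z | y z. y \<in> Zr d F (r - 1) (p + 1) n \<and> z \<in> Zr d F (r - 1) (p - r + 1) (n - 1)}"

definition Er_cyc :: "('a \<Rightarrow> 'a) \<Rightarrow> (int \<Rightarrow> int \<Rightarrow> 'a set) \<Rightarrow> int \<Rightarrow> int \<Rightarrow> int \<Rightarrow> 'a::ab_group_add set" where
  "Er_cyc d F r p n = {x \<in> Zr d F r p n. d x \<in> Nr d F r (p + r) (n + 1)}"

text \<open>the class of x in E_r^{p,n} is a d_r-boundary (zero in H(E_r, d_r))\<close>
definition Er_hzero :: "('a \<Rightarrow> 'a) \<Rightarrow> (int \<Rightarrow> int \<Rightarrow> 'a set) \<Rightarrow> int \<Rightarrow> int \<Rightarrow> int \<Rightarrow> 'a::ab_group_add \<Rightarrow> bool" where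
  "Er_hzero d F r p n x \<longleftrightarrow> (\<exists>z\<in>Zr d F r (p - r) (n - 1). x - d z \<in> Nr d F r p n)"

definition Er_quasi_iso :: "('a \<Rightarrow> 'a) \<Rightarrow> (int \<Rightarrow> int \<Rightarrow> 'a set) \<Rightarrow> ('a \<Rightarrow> 'a) \<Rightarrow> (int \<Rightarrow> int \<Rightarrow> 'a set)
    \<Rightarrow> ('a::ab_group_add \<Rightarrow> 'a) \<Rightarrow> int \<Rightarrow> bool" where
  "Er_quasi_iso dM FM dA FA g r \<longleftrightarrow>
     (\<forall>p n. g ` Zr dM FM r p n \<subseteq> Zr dA FA r p n \<and> g ` Nr dM FM r p n \<subseteq> Nr dA FA r p n) \<and>
     (\<forall>p n. \<forall>x\<in>Zr dM FM r p n. dA (g x) - g (dM x) \<in> Nr dA FA r (p + r) (n + 1)) \<and>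
     (\<forall>p n. \<forall>y\<in>Er_cyc dA FA r p n. \<exists>x\<in>Er_cyc dM FM r p n. Er_hzero dA FA r p n (y - g x)) \<and>
     (\<forall>p n. \<forall>x\<in>Er_cyc dM FM r p n. Er_hzero dA FA r p n (g x) \<longrightarrow> Er_hzero dM FM r p n x)"

text \<open>sum over r+s+t = n, s \<ge> 1, of (-1)^(r+st) outer_{r+1+t}(1^r \<otimes> inner_s \<otimes> 1^t) applied to
  homogeneous xs of degrees ns, including the Koszul sign (-1)^(s(|x_1|+...+|x_r|)).\<close>
definition insert_op_sum :: "('k::field \<Rightarrow> 'a::ab_group_add \<Rightarrow> 'a) \<Rightarrow> (nat \<Rightarrow> 'a list \<Rightarrow> 'b::ab_group_add)
    \<Rightarrow> (nat \<Rightarrow> 'a list \<Rightarrow> 'a) \<Rightarrow> ('k \<Rightarrow> 'b \<Rightarrow> 'b) \<Rightarrow> int list \<Rightarrow> 'a list \<Rightarrow> 'b" where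
  "insert_op_sum scale outer inner scaleb ns xs =
     (let n = length xs in
      \<Sum>r\<in>{0..n}. \<Sum>s\<in>{1..n - r}.
        scaleb (ksign (int r + int s * int (n - r - s) + int s * sum_list (take r ns)))
          (outer (r + 1 + (n - r - s)) (take r xs @ [inner s (take s (drop r xs))] @ drop (r + s) xs)))"

definition compositions :: "nat \<Rightarrow> nat list set" where
  "compositions n = {is. set is \<subseteq> {1..n} \<and> sum_list is = n}"

definition block :: "nat list \<Rightarrow> nat \<Rightarrow> 'a list \<Rightarrow> 'a list" where
  "block is j xs = take (is ! j) (drop (sum_list (take j is)) xs)"

text \<open>sum over compositions i_1+...+i_q = n of (-1)^w m'_q(f_{i_1} \<otimes> ... \<otimes> f_{i_q}) applied to xs,
  w = sum_j (q-j)(i_j - 1), with Koszul sign (-1)^(sum_j (1-i_j)(degrees of earlier inputs)).\<close>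
definition comp_sum :: "('k::field \<Rightarrow> 'b::ab_group_add \<Rightarrow> 'b) \<Rightarrow> (nat \<Rightarrow> 'b list \<Rightarrow> 'b)
    \<Rightarrow> (nat \<Rightarrow> 'a list \<Rightarrow> 'b) \<Rightarrow> int list \<Rightarrow> 'a list \<Rightarrow> 'b" where
  "comp_sum scaleb m' f ns xs =
     (\<Sum>is\<in>compositions (length xs).
        scaleb (ksign ((\<Sum>j<length is. int (length is - 1 - j) * (int (is ! j) - 1))
                     + (\<Sum>j<length is. (1 - int (is ! j)) * sum_list (take (sum_list (take j is)) ns))))
          (m' (length is) (map (\<lambda>j. f (is ! j) (block is j xs)) [0..<length is])))"

definition ainf_alg :: "('k::field \<Rightarrow> 'a::ab_group_add \<Rightarrow> 'a) \<Rightarrow> (int \<Rightarrow> 'a set) \<Rightarrow> (nat \<Rightarrow> 'a list \<Rightarrow> 'a) \<Rightarrow> bool" where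
  "ainf_alg scale G m \<longleftrightarrow>
     graded_vs scale G \<and>
     (\<forall>s\<ge>1. multilin_on scale (tot scale G) s (m s)) \<and>
     (\<forall>s ns xs. s \<ge> 1 \<longrightarrow> length ns = s \<longrightarrow> homog G ns xs \<longrightarrow> m s xs \<in> G (sum_list ns + 2 - int s)) \<and>
     (\<forall>ns xs. length ns \<ge> 1 \<longrightarrow> homog G ns xs \<longrightarrow> insert_op_sum scale m m scale ns xs = 0)"

definition ainf_morph :: "('k::field \<Rightarrow> 'a::ab_group_add \<Rightarrow> 'a) \<Rightarrow> (int \<Rightarrow> 'a set) \<Rightarrow> (nat \<Rightarrow> 'a list \<Rightarrow> 'a)
    \<Rightarrow> ('k \<Rightarrow> 'b::ab_group_add \<Rightarrow> 'b) \<Rightarrow> (int \<Rightarrow> 'b set) \<Rightarrow> (nat \<Rightarrow> 'b list \<Rightarrow> 'b)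
    \<Rightarrow> (nat \<Rightarrow> 'a list \<Rightarrow> 'b) \<Rightarrow> bool" where
  "ainf_morph scale G m scaleb G' m' f \<longleftrightarrow>
     (\<forall>s\<ge>1. \<forall>xs. length xs = s \<longrightarrow> set xs \<subseteq> tot scale G \<longrightarrow>
        (\<forall>i<s. \<forall>c u v. u \<in> tot scale G \<longrightarrow> v \<in> tot scale G \<longrightarrow>
           f s (xs[i := scale c u + v]) = scaleb c (f s (xs[i := u])) + f s (xs[i := v]))) \<and>
     (\<forall>s ns xs. s \<ge> 1 \<longrightarrow> length ns = s \<longrightarrow> homog G ns xs \<longrightarrow> f s xs \<in> G' (sum_list ns + 1 - int s)) \<and>
     (\<forall>ns xs. length ns \<ge> 1 \<longrightarrow> homog G ns xs \<longrightarrow>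
        insert_op_sum scale f m scaleb ns xs = comp_sum scaleb m' f ns xs)"

definition dga_ainf :: "('a \<Rightarrow> 'a) \<Rightarrow> ('a \<Rightarrow> 'a \<Rightarrow> 'a) \<Rightarrow> nat \<Rightarrow> 'a list \<Rightarrow> 'a::zero" where
  "dga_ainf d mu s xs = (if s = 1 then d (hd xs) else if s = 2 then mu (hd xs) (hd (tl xs)) else 0)"

definition Er_minimal_model :: "('k::field \<Rightarrow> 'a::ab_group_add \<Rightarrow> 'a) \<Rightarrow> (int \<Rightarrow> 'a set) \<Rightarrow> ('a \<Rightarrow> 'a)
    \<Rightarrow> ('a \<Rightarrow> 'a \<Rightarrow> 'a) \<Rightarrow> (int \<Rightarrow> int \<Rightarrow> 'a set) \<Rightarrow> int
    \<Rightarrow> (int \<Rightarrow> int \<Rightarrow> 'a set) \<Rightarrow> (nat \<Rightarrow> 'a list \<Rightarrow> 'a) \<Rightarrow> (nat \<Rightarrow> 'a list \<Rightarrow> 'a) \<Rightarrow> bool" where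
  "Er_minimal_model scale G d mu F r M nu f \<longleftrightarrow>
     (let MG = (\<lambda>n. module.span scale (\<Union>p. M p (n - p)));
          FM = (\<lambda>p n. module.span scale (\<Union>p'\<in>{p..}. M p' (n - p')))
      in (\<forall>p q. module.subspace scale (M p q)) \<and>
         direct_family (\<lambda>(p, q). M p q) \<and>
         ainf_alg scale MG nu \<and>
         (\<forall>p q x. x \<in> M p q \<longrightarrow>
            nu 1 [x] \<in> module.span scale (\<Union>k::nat. M (p + r + int k + 1) (q - r - int k))) \<and>
         (\<forall>s ps qs xs. s \<ge> 2 \<longrightarrow> length ps = s \<longrightarrow> length qs = s \<longrightarrow> length xs = s \<longrightarrow>
            (\<forall>i<s. xs ! i \<in> M (ps ! i) (qs ! i)) \<longrightarrow>
            nu s xs \<in> module.span scale (\<Union>k::nat. M (sum_list ps + (2 - int s) * r + int k)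
                                                 (sum_list qs + (2 - int s) * (1 - r) - int k))) \<and>
         ainf_morph scale MG nu scale G (dga_ainf d mu) f \<and>
         (\<forall>s ps qs xs. s \<ge> 1 \<longrightarrow> length ps = s \<longrightarrow> length qs = s \<longrightarrow> length xs = s \<longrightarrow>
            (\<forall>i<s. xs ! i \<in> M (ps ! i) (qs ! i)) \<longrightarrow>
            f s xs \<in> F (sum_list ps + (1 - int s) * r) (sum_list ps + sum_list qs - int s + 1)) \<and>
         Er_quasi_iso (\<lambda>x. nu 1 [x]) FM d F (\<lambda>x. f 1 [x]) r)"

end

theory Submission
  imports Defs
begin

text \<open>
  Over a field, a filtered complex admits a homotopy \<open>h\<close> lowering the filtration by at most \<open>r\<close> such
  that \<open>P = 1 - d h - h d\<close> is a filtered projection with \<open>h P = 0\<close>, on whose image \<open>d\<close> raises the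
  filtration by at least \<open>r + 1\<close>: contract the complex with respect to the associated graded, shift the
  filtration of the remaining part so that its differential preserves it, and iterate \<open>r + 1\<close> times.
  Homotopy transfer along \<open>h\<close> (Merkulov's formulas \<open>f_1 = 1\<close>, \<open>f_n = - h L_n\<close>, \<open>\<nu>_n = P L_n\<close> with
  \<open>L_n = \<Sum> \<plusminus> \<mu> (f_i, f_j)\<close>, \<open>i + j = n\<close>) yields operations in which \<open>h\<close> occurs \<open>n - 2\<close> times in
  \<open>\<nu>_n\<close> and \<open>n - 1\<close> times in \<open>f_n\<close>, which is the required filtration shift; \<open>h\<close> itself is an
  \<open>r\<close>-homotopy and makes the inclusion of the image of \<open>P\<close> a quasi-isomorphism of \<open>r\<close>-th pages.

  The identities are proved in the suspended (bar) sign convention, where every Koszul sign is an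
  application of the involution \<open>x \<mapsto> (-1)^(|x| - 1) x\<close>. The relations of \<open>\<nu>\<close> follow from those of
  \<open>f\<close> because \<open>f_1\<close> is injective.
\<close>

section \<open>Sums over splittings and insertions\<close>

text \<open>This is evaluation on the deconcatenation coproduct of the tensor coalgebra. The
  recursion moves one letter at a time into the first argument, so identities follow by list
  induction with \<open>g\<close> generalized, without arithmetic on cut positions.\<close>

fun split_sum :: "('a list \<Rightarrow> 'a list \<Rightarrow> 'b::ab_group_add) \<Rightarrow> 'a list \<Rightarrow> 'b" where
  "split_sum g [] = g [] []"
| "split_sum g (x # xs) = g [] (x # xs) + split_sum (\<lambda>u. g (x # u)) xs"

lemma split_sum_conv_sum: "split_sum g xs = (\<Sum>k\<le>length xs. g (take k xs) (drop k xs))"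
  by (induction xs arbitrary: g) (simp_all add: sum.atMost_Suc_shift del: sum.atMost_Suc)

lemma split_sum_cong [fundef_cong]:
  assumes "xs = ys" "\<And>u v. u @ v = ys \<Longrightarrow> g u v = g' u v"
  shows "split_sum g xs = split_sum g' ys"
  using assms by (auto simp: split_sum_conv_sum intro!: sum.cong)

lemma split_sum_add: "split_sum (\<lambda>u v. g u v + g' u v) xs = split_sum g xs + split_sum g' xs"
  by (simp add: split_sum_conv_sum sum.distrib)

lemma split_sum_zero: "split_sum (\<lambda>u v. 0) xs = 0"
  by (simp add: split_sum_conv_sum)

lemma split_sum_hom:
  assumes "\<And>x y. h (x + y) = h x + h y"
  shows "h (split_sum g xs) = split_sum (\<lambda>u v. h (g u v)) xs"
  by (induction xs arbitrary: g) (simp_all add: assms)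

text \<open>Coassociativity of deconcatenation: both sides run over the factorizations of
  \<open>xs\<close> into three consecutive words.\<close>

lemma split_sum_assoc:
  "split_sum (\<lambda>u w. split_sum (\<lambda>a c. g u a c) w) xs
     = split_sum (\<lambda>v c. split_sum (\<lambda>u a. g u a c) v) xs"
proof (induction xs arbitrary: g)
  case (Cons x xs)
  show ?case
    using Cons.IH[of "\<lambda>u a c. g (x # u) a c"] by (simp add: split_sum_add add.assoc)
qed simp

lemma split_sum_right_Nil: "split_sum (\<lambda>u w. if w = [] then g u else 0) xs = g xs"
  by (induction xs arbitrary: g) simp_all

text \<open>A cut lies either to the left or to the right of \<open>y\<close>, so the marked letter
  sits in exactly one factor. This serves to prove linearity in that letter.\<close>

lemma split_sum_append_Cons:
  "split_sum g (pre @ y # post)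
     = split_sum (\<lambda>a c. g a (c @ y # post)) pre + split_sum (\<lambda>a c. g (pre @ y # a) c) post"
  by (induction pre arbitrary: g) (simp_all add: add.assoc)

lemma split_sum_map: "split_sum g (map f xs) = split_sum (\<lambda>u v. g (map f u) (map f v)) xs"
  by (induction xs arbitrary: g) simp_all

text \<open>The coderivation of the tensor coalgebra induced by \<open>b\<close>, followed by
  \<open>T\<close>. Each letter to the left of the inserted block is twisted by \<open>t\<close>,
  which is the Koszul sign of an operation of odd degree; only nonempty blocks are inserted.\<close>

fun insert_sum :: "('a \<Rightarrow> 'a) \<Rightarrow> ('a list \<Rightarrow> 'a) \<Rightarrow> ('a list \<Rightarrow> 'b::ab_group_add) \<Rightarrow> 'a list \<Rightarrow> 'b" where
  "insert_sum t b T [] = 0"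
| "insert_sum t b T (x # xs)
     = split_sum (\<lambda>u w. T (b (x # u) # w)) xs + insert_sum t b (\<lambda>ys. T (t x # ys)) xs"

lemma insert_sum_cong:
  assumes "\<And>ys. ys \<noteq> [] \<Longrightarrow> T ys = T' ys"
  shows "insert_sum t b T xs = insert_sum t b T' xs"
  using assms
proof (induction xs arbitrary: T T')
  case (Cons x xs)
  have "insert_sum t b (\<lambda>ys. T (t x # ys)) xs = insert_sum t b (\<lambda>ys. T' (t x # ys)) xs"
    by (rule Cons.IH) (simp add: Cons.prems)
  then show ?case by (simp add: Cons.prems)
qed simp

lemma insert_sum_add:
  "insert_sum t b (\<lambda>ys. T ys + T' ys) xs = insert_sum t b T xs + insert_sum t b T' xs"
  by (induction xs arbitrary: T T') (simp_all add: split_sum_add algebra_simps)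

lemma insert_sum_zero: "insert_sum t b (\<lambda>ys. 0) xs = 0"
  by (induction xs) (simp_all add: split_sum_zero)

lemma insert_sum_hom:
  assumes "\<And>x y. h (x + y) = h x + h y"
  shows "insert_sum t b (\<lambda>ys. h (T ys)) xs = h (insert_sum t b T xs)"
proof -
  have "h 0 = 0" using assms[of 0 0] by simp
  then show ?thesis
    by (induction xs arbitrary: T) (simp_all add: assms split_sum_hom[where h=h, OF assms])
qed

text \<open>The coderivation property: after the cut the inserted letter lies in one of the two
  factors, and if it lies in the right one, the whole left factor has been passed and is
  twisted.\<close>

lemma insert_sum_split_sum:
  "insert_sum t b (split_sum g) xs
     = split_sum (\<lambda>u v. insert_sum t b (\<lambda>u'. g u' v) u + insert_sum t b (\<lambda>v'. g (map t u) v') v) xs"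
proof (induction xs arbitrary: g)
  case (Cons x xs)
  show ?case
    by (simp add: insert_sum_add split_sum_add Cons.IH split_sum_assoc[of "\<lambda>u a c. g (b (x # u) # a) c"]
        algebra_simps)
qed simp

text \<open>Connects the recursive form with the double sum over \<open>r\<close> and
  \<open>s\<close> in \<open>insert_op_sum\<close>.\<close>

lemma insert_sum_conv_sum:
  "insert_sum t b T xs = (\<Sum>r\<in>{0..length xs}. \<Sum>s\<in>{1..length xs - r}.
      T (map t (take r xs) @ [b (take s (drop r xs))] @ drop (r + s) xs))"
proof (induction xs arbitrary: T)
  case (Cons x xs)
  let ?g = "\<lambda>r. \<Sum>s\<in>{1..length (x # xs) - r}.
      T (map t (take r (x # xs)) @ [b (take s (drop r (x # xs)))] @ drop (r + s) (x # xs))"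
  have "?g 0 = split_sum (\<lambda>u w. T (b (x # u) # w)) xs"
    unfolding split_sum_conv_sum
    by (rule sum.reindex_bij_witness[of _ Suc "\<lambda>s. s - 1"]) (auto simp: take_Cons' drop_Cons')
  moreover have "(\<Sum>r\<in>{0..length xs}. ?g (Suc r)) = insert_sum t b (\<lambda>ys. T (t x # ys)) xs"
    by (simp add: Cons.IH)
  moreover have "(\<Sum>r\<in>{0..length (x # xs)}. ?g r) = ?g 0 + (\<Sum>r\<in>{0..length xs}. ?g (Suc r))"
    unfolding list.size(4) add_Suc_right add_0_right sum.atLeast0_atMost_Suc_shift by (simp only: comp_def)
  ultimately show ?case by (simp only: insert_sum.simps)
qed simp

section \<open>Transfer in the bar convention\<close>

text \<open>In the suspended convention \<open>d\<close>, \<open>h\<close> and \<open>m\<close> all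
  have odd degree, so each anticommutes with the sign involution \<open>t\<close>, and
  \<open>d_m\<close> and \<open>m_assoc\<close> are the A-infinity relations of a dg-algebra without
  further signs. The equations are imposed on all elements, so degrees never enter. The homotopy
  property of \<open>h\<close> comes in only later.\<close>

locale bar_transfer = vector_space scale
  for scale :: "'k::field \<Rightarrow> 'a::ab_group_add \<Rightarrow> 'a" +
  fixes d h t :: "'a \<Rightarrow> 'a" and m :: "'a \<Rightarrow> 'a \<Rightarrow> 'a"
  assumes d_lin: "d (scale c x + y) = scale c (d x) + d y"
    and h_lin: "h (scale c x + y) = scale c (h x) + h y"
    and t_lin: "t (scale c x + y) = scale c (t x) + t y"
    and m_lin_left: "m (scale c x + x') y = scale c (m x y) + m x' y"
    and m_lin_right: "m x (scale c y + y') = scale c (m x y) + m x y'"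
    and t_t: "t (t x) = x"
    and d_t: "d (t x) = - t (d x)"
    and h_t: "h (t x) = - t (h x)"
    and t_m: "t (m x y) = - m (t x) (t y)"
    and d_d: "d (d x) = 0"
    and d_m: "d (m x y) = - m (d x) y - m (t x) (d y)"
    and m_assoc: "m (m x y) z + m (t x) (m y z) = 0"
begin

lemma d_add: "d (x + y) = d x + d y" using d_lin[of 1] by simp
lemma h_add: "h (x + y) = h x + h y" using h_lin[of 1] by simp
lemma t_add: "t (x + y) = t x + t y" using t_lin[of 1] by simp
lemma m_add_left: "m (x + x') y = m x y + m x' y" using m_lin_left[of 1] by simp
lemma m_add_right: "m x (y + y') = m x y + m x y'" using m_lin_right[of x 1] by simp

lemma d_0 [simp]: "d 0 = 0" using d_add[of 0 0] by simp
lemma h_0 [simp]: "h 0 = 0" using h_add[of 0 0] by simp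
lemma t_0 [simp]: "t 0 = 0" using t_add[of 0 0] by simp
lemma m_0_left [simp]: "m 0 y = 0" using m_add_left[of 0 0] by simp
lemma m_0_right [simp]: "m x 0 = 0" using m_add_right[of x 0 0] by simp

lemma d_minus: "d (- x) = - d x" using d_add[of x "- x"] by (simp add: eq_neg_iff_add_eq_0 add.commute)
lemma h_minus: "h (- x) = - h x" using h_add[of x "- x"] by (simp add: eq_neg_iff_add_eq_0 add.commute)
lemma t_minus: "t (- x) = - t x" using t_add[of x "- x"] by (simp add: eq_neg_iff_add_eq_0 add.commute)
lemma t_diff: "t (x - y) = t x - t y" using t_add[of "x - y" y] by simp

text \<open>Merkulov's recursion for the components of the transferred morphism. Only cuts into two
  nonempty words occur, which gives termination; \<open>sum_list\<close> supplies the value on short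
  words, 0 on the empty one and the letter itself on a single one.\<close>

function tmor :: "'a list \<Rightarrow> 'a" where
  "tmor xs = (if length xs \<le> 1 then sum_list xs
      else - h (\<Sum>k\<in>{1..<length xs}. m (tmor (take k xs)) (tmor (drop k xs))))"
  by pat_completeness auto
termination by (relation "measure length") auto

declare tmor.simps [simp del]

lemma tmor_Nil [simp]: "tmor [] = 0" and tmor_single [simp]: "tmor [x] = x"
  by (simp_all add: tmor.simps)

text \<open>All cuts are included so that the lemmas on \<open>split_sum\<close> apply; the two
  trivial cuts contribute nothing because \<open>tmor []\<close> is 0.\<close>

definition tprod :: "'a list \<Rightarrow> 'a" where
  "tprod = split_sum (\<lambda>u v. m (tmor u) (tmor v))"

text \<open>Chosen so that the morphism equation \<open>bar_insert_tmor\<close> holds. One formula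
  covers all lengths: on a single letter it is \<open>d\<close>, and on longer words, where
  \<open>tmor\<close> is \<open>- h\<close> of \<open>tprod\<close>, it is
  \<open>1 - d h - h d\<close> applied to \<open>tprod\<close>.\<close>

definition tbar :: "'a list \<Rightarrow> 'a" where
  "tbar xs = tprod xs + d (tmor xs) - h (d (tprod xs))"

lemma tmor_eq: "tmor xs = (if length xs = 1 then hd xs else 0) - h (tprod xs)"
proof -
  consider "xs = []" | x where "xs = [x]" | "length xs \<ge> 2"
    by (cases xs rule: remdups_adj.cases) auto
  then show ?thesis
  proof cases
    case 3
    have "tprod xs = (\<Sum>k\<le>length xs. m (tmor (take k xs)) (tmor (drop k xs)))"
      by (simp add: tprod_def split_sum_conv_sum)
    also have "\<dots> = (\<Sum>k\<in>{1..<length xs}. m (tmor (take k xs)) (tmor (drop k xs)))"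
      by (rule sum.mono_neutral_right) (auto simp: not_less Suc_le_eq)
    finally show ?thesis using 3 by (subst tmor.simps) simp
  qed (simp_all add: tprod_def)
qed

lemma tbar_Nil [simp]: "tbar [] = 0" and tbar_single [simp]: "tbar [x] = d x"
  by (simp_all add: tbar_def tprod_def)

lemma tbar_eq:
  assumes "length xs \<ge> 2"
  shows "tbar xs = tprod xs - d (h (tprod xs)) - h (d (tprod xs))"
  using assms by (simp add: tbar_def tmor_eq[of xs] d_minus)

text \<open>Every \<open>m\<close> and every \<open>h\<close> contributes one sign. On
  \<open>n\<close> letters there are \<open>n - 1\<close> of each in \<open>tmor\<close>, and one
  \<open>h\<close> less in \<open>tprod\<close>, so the former is even and the latter odd.\<close>

lemma tmor_map_t: "tmor (map t xs) = t (tmor xs)"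
  and tprod_map_t: "tprod (map t xs) = - t (tprod xs)"
proof (induction "length xs" arbitrary: xs rule: less_induct)
  case less
  \<comment> \<open>The claim on \<open>tprod\<close> needs \<open>tmor\<close> only on shorter
    words; it comes first because the claim on \<open>tmor\<close> uses it for the same
    word.\<close>
  { case 2
    have *: "m (tmor (map t u)) (tmor (map t v)) = - t (m (tmor u) (tmor v))" if "u @ v = xs" for u v
    proof (cases "u = [] \<or> v = []")
      case False
      then have "tmor (map t u) = t (tmor u)" "tmor (map t v) = t (tmor v)"
        using that less(1) by auto
      then show ?thesis by (simp add: t_m)
    qed auto
    show ?case
      by (simp add: tprod_def split_sum_map * split_sum_hom[where h="\<lambda>x. - t x"] t_add cong: split_sum_cong)
    note this }
  note prod = this
  { case 1
    show ?case
      unfolding tmor_eq[of xs] tmor_eq[of "map t xs"] prod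
      by (cases xs) (auto simp: h_minus h_t t_add t_minus t_diff)
  }
qed

lemma tbar_map_t: "tbar (map t xs) = - t (tbar xs)"
  by (simp add: tbar_def tmor_map_t tprod_map_t d_t h_t t_add t_minus t_diff d_minus h_minus)

abbreviation "bar_insert \<equiv> insert_sum t tbar"

text \<open>A word of one letter arises only by inserting the whole of \<open>xs\<close> at
  once.\<close>

lemma bar_insert_hd: "bar_insert (\<lambda>ys. if length ys = 1 then hd ys else 0) xs = tbar xs"
proof (cases xs)
  case (Cons x zs)
  have "bar_insert (\<lambda>ys. if length (t x # ys) = 1 then hd (t x # ys) else 0) zs
      = bar_insert (\<lambda>ys. 0) zs"
    by (rule insert_sum_cong) auto
  then show ?thesis
    using split_sum_right_Nil[of "\<lambda>u. tbar (x # u)" zs] by (simp add: Cons insert_sum_zero cong: if_cong split_sum_cong)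
qed simp

text \<open>The first identity is the morphism equation in bar form. The induction passes through
  \<open>tprod\<close>: the Leibniz rule collects the terms with \<open>d\<close>, the induction
  hypothesis on the two factors adds triple products, and these cancel by associativity.\<close>

theorem bar_insert_tmor: "bar_insert tmor xs = d (tmor xs) + tprod xs"
  and bar_insert_tprod: "bar_insert tprod xs = - d (tprod xs)"
proof (induction "length xs" arbitrary: xs rule: less_induct)
  case less
  { case 2
    let ?F = "\<lambda>u v. m (tmor u) (tmor v)"
    have *: "bar_insert (\<lambda>u'. ?F u' v) u + bar_insert (\<lambda>v'. ?F (map t u) v') v
        = - d (?F u v) + (m (tprod u) (tmor v) + m (t (tmor u)) (tprod v))" if "u @ v = xs" for u v
    proof -
      have "bar_insert (\<lambda>u'. ?F u' v) u = m (bar_insert tmor u) (tmor v)"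
        by (rule insert_sum_hom[where h="\<lambda>x. m x (tmor v)"]) (rule m_add_left)
      moreover have "bar_insert (\<lambda>v'. ?F (map t u) v') v = m (t (tmor u)) (bar_insert tmor v)"
        unfolding tmor_map_t by (rule insert_sum_hom[where h="m (t (tmor u))"]) (rule m_add_right)
      moreover have "m (bar_insert tmor u) (tmor v) = m (d (tmor u) + tprod u) (tmor v)"
        using less(1)[of u] that by (cases "v = []") auto
      moreover have "m (t (tmor u)) (bar_insert tmor v) = m (t (tmor u)) (d (tmor v) + tprod v)"
        using less(1)[of v] that by (cases "u = []") auto
      ultimately show ?thesis by (simp add: d_m m_add_left m_add_right)
    qed
    have l: "m (tprod u) (tmor v) = split_sum (\<lambda>a b. m (?F a b) (tmor v)) u" for u v
      unfolding tprod_def by (rule split_sum_hom[where h="\<lambda>x. m x (tmor v)"]) (rule m_add_left)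
    have r: "m (t (tmor u)) (tprod v) = split_sum (\<lambda>a b. m (t (tmor u)) (?F a b)) v" for u v
      unfolding tprod_def by (rule split_sum_hom[where h="m (t (tmor u))"]) (rule m_add_right)
    have "bar_insert tprod xs = split_sum (\<lambda>u v. - d (?F u v)) xs
        + split_sum (\<lambda>u v. m (tprod u) (tmor v) + m (t (tmor u)) (tprod v)) xs"
      unfolding tprod_def insert_sum_split_sum
      unfolding tprod_def[symmetric] split_sum_add[symmetric]
      by (rule split_sum_cong[OF refl *])
    \<comment> \<open>Coassociativity brings both kinds of triple products to the same indexing,
      where \<open>m_assoc\<close> cancels them term by term.\<close>
    also have "split_sum (\<lambda>u v. m (tprod u) (tmor v) + m (t (tmor u)) (tprod v)) xs = 0"
      unfolding split_sum_add l r split_sum_assoc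
      unfolding split_sum_add[symmetric]
      by (simp add: m_assoc split_sum_zero)
    also have "split_sum (\<lambda>u v. - d (?F u v)) xs = - d (tprod xs)"
      unfolding tprod_def by (rule split_sum_hom[where h="\<lambda>x. - d x", symmetric]) (simp add: d_add)
    finally show ?case by simp
    note this }
  note prod = this
  { case 1
    \<comment> \<open>Apart from the length-one term, \<open>tmor\<close> is \<open>- h\<close> of
      \<open>tprod\<close>, and this \<open>h\<close> is applied after the insertion, so it is
      pulled out without an extra sign. The definition of \<open>tbar\<close> then absorbs the
      resulting \<open>h (d (tprod xs))\<close>.\<close>
    have "bar_insert tmor xs
        = bar_insert (\<lambda>ys. (if length ys = 1 then hd ys else 0) + - h (tprod ys)) xs"
      by (rule insert_sum_cong) (subst tmor_eq, simp)
    also have "\<dots> = tbar xs + - h (bar_insert tprod xs)"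
      unfolding insert_sum_add bar_insert_hd
      by (subst insert_sum_hom[where h="\<lambda>x. - h x"]) (simp_all add: h_add)
    also have "\<dots> = d (tmor xs) + tprod xs"
      by (simp add: prod tbar_def h_minus)
    finally show ?case . }
qed

section \<open>Multilinearity of the transferred operations\<close>

definition multilinear :: "('a list \<Rightarrow> 'a) \<Rightarrow> bool" where
  "multilinear T \<longleftrightarrow> (\<forall>pre post c u v.
     T (pre @ (scale c u + v) # post) = scale c (T (pre @ u # post)) + T (pre @ v # post))"

lemma multilinearD:
  "multilinear T \<Longrightarrow> T (pre @ (scale c u + v) # post) = scale c (T (pre @ u # post)) + T (pre @ v # post)"
  unfolding multilinear_def by blast

lemma multilinear_Cons: "multilinear T \<Longrightarrow> multilinear (\<lambda>ys. T (x # ys))"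
  unfolding multilinear_def by (metis append_Cons)

lemma multilinear_add_head: "multilinear T \<Longrightarrow> T ((u + v) # ys) = T (u # ys) + T (v # ys)"
  using multilinearD[of T "[]" 1 u v ys] by simp

lemma multilinear_zero: "multilinear T \<Longrightarrow> T (pre @ 0 # post) = 0"
  using multilinearD[of T pre 1 0 0 post] by simp

lemma multilinear_scale: "multilinear T \<Longrightarrow> T (pre @ scale c u # post) = scale c (T (pre @ u # post))"
  using multilinearD[of T pre c u 0 post] multilinear_zero[of T pre post] by simp

lemma multilinear_minus_head: "multilinear T \<Longrightarrow> T (- u # ys) = - T (u # ys)"
  using multilinear_scale[of T "[]" "-1" u ys] by simp

lemma split_sum_scale_add:
  "split_sum (\<lambda>u v. scale c (g u v) + g' u v) xs = scale c (split_sum g xs) + split_sum g' xs"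
  by (simp add: split_sum_add split_sum_hom[where h="scale c"] scale_right_distrib)

lemma tmor_tprod_multilinear:
  "tmor (pre @ (scale c x + y) # post) = scale c (tmor (pre @ x # post)) + tmor (pre @ y # post)
   \<and> tprod (pre @ (scale c x + y) # post) = scale c (tprod (pre @ x # post)) + tprod (pre @ y # post)"
proof (induction "length pre + length post" arbitrary: pre post rule: less_induct)
  case less
  have 1: "split_sum (\<lambda>a e. m (tmor a) (tmor (e @ (scale c x + y) # post))) pre
     = split_sum (\<lambda>a e. scale c (m (tmor a) (tmor (e @ x # post))) + m (tmor a) (tmor (e @ y # post))) pre"
  proof (rule split_sum_cong[OF refl])
    fix a e assume "a @ e = pre"
    then show "m (tmor a) (tmor (e @ (scale c x + y) # post))
      = scale c (m (tmor a) (tmor (e @ x # post))) + m (tmor a) (tmor (e @ y # post))"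
      using less[of e post] by (cases "a = []") (auto simp: m_lin_right)
  qed
  have 2: "split_sum (\<lambda>a e. m (tmor (pre @ (scale c x + y) # a)) (tmor e)) post
     = split_sum (\<lambda>a e. scale c (m (tmor (pre @ x # a)) (tmor e)) + m (tmor (pre @ y # a)) (tmor e)) post"
  proof (rule split_sum_cong[OF refl])
    fix a e assume "a @ e = post"
    then show "m (tmor (pre @ (scale c x + y) # a)) (tmor e)
      = scale c (m (tmor (pre @ x # a)) (tmor e)) + m (tmor (pre @ y # a)) (tmor e)"
      using less[of pre a] by (cases "e = []") (auto simp: m_lin_left)
  qed
  have p: "tprod (pre @ (scale c x + y) # post) = scale c (tprod (pre @ x # post)) + tprod (pre @ y # post)"
    unfolding tprod_def split_sum_append_Cons 1 2 split_sum_scale_add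
    by (simp add: scale_right_distrib)
  moreover have "tmor (pre @ (scale c x + y) # post) = scale c (tmor (pre @ x # post)) + tmor (pre @ y # post)"
    unfolding tmor_eq[of "pre @ _"] p h_lin by (cases pre) (auto simp: scale_right_distrib scale_right_diff_distrib)
  ultimately show ?case by blast
qed

lemma multilinear_tmor: "multilinear tmor"
  unfolding multilinear_def using tmor_tprod_multilinear by blast

lemma multilinear_tbar: "multilinear tbar"
  unfolding multilinear_def tbar_def
  by (simp add: tmor_tprod_multilinear d_lin h_lin scale_right_distrib scale_right_diff_distrib)

lemma multilinear_split_sum_head:
  "multilinear T \<Longrightarrow> T (split_sum g xs # ys) = split_sum (\<lambda>u v. T (g u v # ys)) xs"
  by (rule split_sum_hom[where h="\<lambda>x. T (x # ys)"]) (rule multilinear_add_head)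

lemma multilinear_insert_sum_head:
  "multilinear T \<Longrightarrow> T (insert_sum s b g xs # ys) = insert_sum s b (\<lambda>zs. T (g zs # ys)) xs"
  by (rule insert_sum_hom[where h="\<lambda>x. T (x # ys)", symmetric]) (rule multilinear_add_head)

text \<open>Insertions at disjoint places cancel in pairs; inserting an operation into an inserted one
  gives the insertion of the iterated operation, with trivial signs.\<close>
lemma bar_insert_bar_insert:
  "multilinear T \<Longrightarrow> bar_insert (bar_insert T) xs = insert_sum (\<lambda>x. x) (bar_insert tbar) T xs"
proof (induction xs arbitrary: T)
  case (Cons x xs)
  \<comment> \<open>Since \<open>tbar\<close> is odd, twisting the letters of a block costs a sign
    against twisting the result. With this sign, insertions into disjoint blocks cancel.\<close>
  have c: "bar_insert (\<lambda>v'. T (tbar (t x # map t u) # v')) v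
      = - bar_insert (\<lambda>v'. T (t (tbar (x # u)) # v')) v" for u v
    using tbar_map_t[of "x # u"] Cons.prems
    by (simp add: multilinear_minus_head insert_sum_hom[where h=uminus])
  \<comment> \<open>The four cases: both insertions start at the head, only the first, only the
    second, or neither. In the last one \<open>x\<close> is twisted twice, which leaves it
    unchanged.\<close>
  have "bar_insert (bar_insert T) (x # xs)
     = split_sum (\<lambda>u w. split_sum (\<lambda>a e. T (tbar (tbar (x # u) # a) # e)) w) xs
     + split_sum (\<lambda>u w. bar_insert (\<lambda>ys. T (t (tbar (x # u)) # ys)) w) xs
     + bar_insert (split_sum (\<lambda>a e. T (tbar (t x # a) # e))) xs
     + bar_insert (bar_insert (\<lambda>zs. T (x # zs))) xs"
    by (simp add: split_sum_add insert_sum_add t_t algebra_simps)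
  also have "bar_insert (split_sum (\<lambda>a e. T (tbar (t x # a) # e))) xs
     = split_sum (\<lambda>u v. bar_insert (\<lambda>u'. T (tbar (t x # u') # v)) u) xs
       + split_sum (\<lambda>u v. - bar_insert (\<lambda>v'. T (t (tbar (x # u)) # v')) v) xs"
    unfolding insert_sum_split_sum c split_sum_add[symmetric] ..
  also have "split_sum (\<lambda>u v. - bar_insert (\<lambda>v'. T (t (tbar (x # u)) # v')) v) xs
     = - split_sum (\<lambda>u w. bar_insert (\<lambda>ys. T (t (tbar (x # u)) # ys)) w) xs"
    by (rule split_sum_hom[where h=uminus, symmetric]) simp
  also have "bar_insert (bar_insert (\<lambda>zs. T (x # zs))) xs
     = insert_sum (\<lambda>x. x) (bar_insert tbar) (\<lambda>zs. T (x # zs)) xs"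
    by (rule Cons.IH) (rule multilinear_Cons[OF Cons.prems])
  finally show ?case
    using Cons.prems
    by (simp add: split_sum_assoc[of "\<lambda>u a e. T (tbar (tbar (x # u) # a) # e)"] split_sum_add
        multilinear_add_head multilinear_split_sum_head multilinear_insert_sum_head)
qed simp

text \<open>Fits a strong induction on word length: if \<open>b\<close> vanishes on all shorter
  blocks, only the block consisting of the whole word survives.\<close>

lemma insert_sum_only_total:
  assumes "\<And>v. length v < length xs \<Longrightarrow> b v = 0" "multilinear T" "xs \<noteq> []"
  shows "insert_sum (\<lambda>x. x) b T xs = T [b xs]"
proof -
  have z: "insert_sum (\<lambda>x. x) b T zs = 0" if "\<And>v. length v \<le> length zs \<Longrightarrow> b v = 0" "multilinear T" for T zs
    using that
  proof (induction zs arbitrary: T)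
    case (Cons z zs)
    have "split_sum (\<lambda>u w. T (b (z # u) # w)) zs = split_sum (\<lambda>u w. 0) zs"
      using Cons.prems multilinear_zero[of T "[]"] by (intro split_sum_cong) auto
    moreover have "insert_sum (\<lambda>x. x) b (\<lambda>ys. T (z # ys)) zs = 0"
      by (rule Cons.IH) (use Cons.prems multilinear_Cons in auto)
    ultimately show ?case by (simp add: split_sum_zero)
  qed simp
  obtain x zs where xs: "xs = x # zs" using assms(3) by (cases xs) auto
  have "split_sum (\<lambda>u w. T (b (x # u) # w)) zs
      = split_sum (\<lambda>u w. if w = [] then T [b (x # u)] else 0) zs"
    using assms(1) multilinear_zero[OF assms(2), of "[]"] by (intro split_sum_cong) (auto simp: xs)
  moreover have "insert_sum (\<lambda>x. x) b (\<lambda>ys. T (x # ys)) zs = 0"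
    by (rule z) (use assms multilinear_Cons xs in auto)
  ultimately show ?thesis using split_sum_right_Nil[of "\<lambda>u. T [b (x # u)]" zs] by (simp add: xs)
qed

text \<open>Derived from the morphism equation: inserting twice into \<open>tmor\<close> gives 0 by
  the two identities of \<open>bar_insert_tmor\<close> and by \<open>d_d\<close>, and since
  \<open>tmor\<close> is the identity on single letters, the relation can be read off.\<close>

theorem bar_insert_tbar: "bar_insert tbar xs = 0"
proof (induction "length xs" arbitrary: xs rule: less_induct)
  case less
  show ?case
  proof (cases "xs = []")
    case False
    \<comment> \<open>By the induction hypothesis shorter blocks give 0, so the sum on the right
      reduces to \<open>tmor\<close> of the single letter \<open>bar_insert tbar xs\<close>.\<close>
    have "bar_insert tbar xs = insert_sum (\<lambda>x. x) (bar_insert tbar) tmor xs"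
      by (subst insert_sum_only_total) (use less False multilinear_tmor in auto)
    also have "\<dots> = bar_insert (bar_insert tmor) xs"
      by (rule bar_insert_bar_insert[OF multilinear_tmor, symmetric])
    also have "\<dots> = bar_insert (\<lambda>ys. d (tmor ys)) xs + bar_insert tprod xs"
      unfolding insert_sum_add[symmetric] by (rule insert_sum_cong) (rule bar_insert_tmor)
    also have "bar_insert (\<lambda>ys. d (tmor ys)) xs = d (bar_insert tmor xs)"
      by (rule insert_sum_hom[where h=d]) (rule d_add)
    also have "d (bar_insert tmor xs) + bar_insert tprod xs = 0"
      by (simp add: bar_insert_tmor bar_insert_tprod d_add d_d)
    finally show ?thesis .
  qed simp
qed

end

section \<open>Linear algebra of filtered spaces\<close>

lemma direct_familyD:
  assumes "direct_family G" "finite I" "\<And>i. i \<in> I \<Longrightarrow> x i \<in> G i" "sum x I = 0" "i \<in> I"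
  shows "x i = 0"
proof -
  have "\<forall>i\<in>I. x i \<in> G i" using assms(3) by (rule ballI)
  then show ?thesis
    using assms(1)[unfolded direct_family_def, THEN spec, THEN spec, of I x] assms(2,4,5) by (elim impE bspec)
qed

locale linear_space = vector_space scale
  for scale :: "'k::field \<Rightarrow> 'a::ab_group_add \<Rightarrow> 'a"
begin

abbreviation "lin \<equiv> Vector_Spaces.linear scale scale"

interpretation endo: vector_space_pair scale scale
  by unfold_locales

lemma lin_iff: "lin g \<longleftrightarrow> (\<forall>c x y. g (scale c x + y) = scale c (g x) + g y)"
proof
  assume "lin g"
  then show "\<forall>c x y. g (scale c x + y) = scale c (g x) + g y"
    by (simp add: endo.linear_add endo.linear_scale)
next
  assume *: "\<forall>c x y. g (scale c x + y) = scale c (g x) + g y"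
  then have add: "g (x + y) = g x + g y" for x y
    using spec[OF spec[OF spec[OF *, of 1], of x], of y] by simp
  then have "g 0 = 0" by (metis add_cancel_right_right)
  then have "g (scale c x) = scale c (g x)" for c x
    using spec[OF spec[OF spec[OF *, of c], of x], of 0] by simp
  with add show "lin g"
    by (simp add: Vector_Spaces.linear_iff vector_space_axioms)
qed

lemma lin_ident: "lin (\<lambda>x. x)"
  and lin_compose: "lin f \<Longrightarrow> lin g \<Longrightarrow> lin (\<lambda>x. f (g x))"
  and lin_add: "lin f \<Longrightarrow> lin g \<Longrightarrow> lin (\<lambda>x. f x + g x)"
  and lin_diff: "lin f \<Longrightarrow> lin g \<Longrightarrow> lin (\<lambda>x. f x - g x)"
  by (simp_all add: lin_iff scale_right_distrib scale_right_diff_distrib)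

section \<open>Projections, complements and gluing of linear maps\<close>

lemma ex_projection:
  assumes "subspace V"
  shows "\<exists>g. range g \<subseteq> V \<and> lin g \<and> (\<forall>v\<in>V. g v = v)"
  using endo.linear_exists_left_inverse_on[OF linear_id assms] by (simp add: id_def inj_on_def)

lemma ex_complement:
  assumes "subspace S" "subspace V" "S \<subseteq> V"
  shows "\<exists>W. subspace W \<and> W \<subseteq> V \<and> W \<inter> S \<subseteq> {0} \<and> (\<forall>v\<in>V. \<exists>w\<in>W. \<exists>s\<in>S. v = w + s)"
proof -
  obtain g where g: "range g \<subseteq> S" "lin g" "\<And>v. v \<in> S \<Longrightarrow> g v = v"
    using ex_projection[OF assms(1)] by blast
  let ?W = "V \<inter> {v. g v = 0}"
  have "subspace ?W"
    by (intro subspace_inter assms endo.linear_subspace_kernel g)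
  moreover have "\<exists>w\<in>?W. \<exists>s\<in>S. v = w + s" if "v \<in> V" for v
  proof (intro bexI)
    show "v = (v - g v) + g v" by simp
    show "g v \<in> S" using g by blast
    then show "v - g v \<in> ?W"
      using that assms g by (auto simp: endo.linear_diff intro: subspace_diff)
  qed
  ultimately show ?thesis using g by (intro exI[of _ ?W]) auto
qed

definition complement :: "'a set \<Rightarrow> 'a set \<Rightarrow> 'a set" where
  "complement S V = (SOME W. subspace W \<and> W \<subseteq> V \<and> W \<inter> S \<subseteq> {0} \<and> (\<forall>v\<in>V. \<exists>w\<in>W. \<exists>s\<in>S. v = w + s))"

lemma complement:
  assumes "subspace S" "subspace V" "S \<subseteq> V"
  shows subspace_complement: "subspace (complement S V)"
    and complement_subset: "complement S V \<subseteq> V"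
    and complement_Int: "complement S V \<inter> S \<subseteq> {0}"
    and complement_decomp: "v \<in> V \<Longrightarrow> \<exists>w\<in>complement S V. \<exists>s\<in>S. v = w + s"
  using someI_ex[OF ex_complement[OF assms]] unfolding complement_def by blast+

text \<open>For a projection \<open>q\<close> onto \<open>X\<close>, the map \<open>1 - q\<close>
  kills \<open>X\<close> and stays injective on \<open>Y\<close>; it is followed by a left inverse
  of its restriction to \<open>Y\<close>.\<close>

lemma ex_projection_along:
  assumes "subspace X" "subspace Y" "X \<inter> Y \<subseteq> {0}"
  shows "\<exists>g. lin g \<and> (\<forall>x\<in>X. g x = 0) \<and> (\<forall>y\<in>Y. g y = y)"
proof -
  obtain q where q: "range q \<subseteq> X" "lin q" "\<And>v. v \<in> X \<Longrightarrow> q v = v"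
    using ex_projection[OF assms(1)] by blast
  let ?q = "\<lambda>x. x - q x"
  have lin: "lin ?q"
    by (intro lin_diff lin_ident q)
  have "inj_on ?q Y"
  proof (subst endo.linear_inj_on_iff_eq_0[OF lin assms(2)], intro ballI impI)
    fix y assume "y \<in> Y" "y - q y = 0"
    moreover have "q y \<in> X" using q by blast
    ultimately show "y = 0" using assms(3) by auto
  qed
  then obtain g where "lin g" "\<And>y. y \<in> Y \<Longrightarrow> g (?q y) = y"
    using endo.linear_exists_left_inverse_on[OF lin assms(2)] by blast
  then show ?thesis
    using q(3) by (intro exI[of _ "\<lambda>x. g (?q x)"]) (auto simp: endo.linear_0 intro: lin_compose lin)
qed

text \<open>Bases of the members are independent together because the family is direct, so values
  can be prescribed on their union.\<close>

lemma ex_linear_on_direct_family: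
  assumes dir: "direct_family W" and sub: "\<And>i. subspace (W i)" and lin: "\<And>i. lin (g i)"
  shows "\<exists>h. lin h \<and> (\<forall>i. \<forall>x\<in>W i. h x = g i x)"
proof -
  have "\<forall>i. \<exists>B. B \<subseteq> W i \<and> independent B \<and> W i \<subseteq> span B"
    using maximal_independent_subset by metis
  then obtain B where B: "\<And>i. B i \<subseteq> W i" "\<And>i. independent (B i)" "\<And>i. W i \<subseteq> span (B i)"
    by metis
  let ?U = "\<Union>i. B i"
  have "\<forall>b\<in>?U. \<exists>i. b \<in> B i" by blast
  then obtain idx where idx: "\<And>b. b \<in> ?U \<Longrightarrow> b \<in> B (idx b)" by metis
  \<comment> \<open>A basis vector determines its index: lying in two members, it would give the
    nontrivial relation \<open>b + (- b) = 0\<close>.\<close>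
  have uniq: "i = j" if "b \<in> B i" "b \<in> B j" for b i j
  proof (rule ccontr)
    assume ne: "i \<noteq> j"
    let ?x = "\<lambda>k. if k = i then b else - b"
    have "sum ?x {i, j} = 0" using ne by simp
    moreover have "b \<in> W i" "- b \<in> W j" using that B(1) subspace_neg[OF sub] by blast+
    then have "?x k \<in> W k" if "k \<in> {i, j}" for k using that by auto
    ultimately have "?x i = 0" by (intro direct_familyD[OF dir, of "{i, j}" ?x i]) auto
    then show False using that(1) B(2) dependent_zero by auto
  qed
  have "independent ?U"
    unfolding independent_explicit_module
  proof (intro allI impI)
    fix T u v assume *: "finite T" "T \<subseteq> ?U" "(\<Sum>v\<in>T. scale (u v) v) = 0" "v \<in> T"
    let ?x = "\<lambda>i. \<Sum>v\<in>{v \<in> T. idx v = i}. scale (u v) v"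
    have sub_B: "{v \<in> T. idx v = i} \<subseteq> B i" for i
      using *(2) idx by fastforce
    have "sum ?x (idx ` T) = 0"
      using sum.image_gen[OF *(1), of "\<lambda>v. scale (u v) v" idx] *(3) by simp
    moreover have "?x i \<in> W i" for i
      using sub_B[of i] B(1)[of i] by (intro subspace_sum sub subspace_scale) auto
    ultimately have "?x (idx v) = 0"
      using *(1,4) by (intro direct_familyD[OF dir, of "idx ` T" ?x]) auto
    then show "u v = 0"
      using B(2)[of "idx v", unfolded independent_explicit_module] *(1,4) sub_B[of "idx v"]
      by (metis (mono_tags, lifting) finite_subset mem_Collect_eq subsetI)
  qed
  then obtain h where h: "lin h" "\<And>b. b \<in> ?U \<Longrightarrow> h b = g (idx b) b"
    using endo.linear_independent_extend[of ?U "\<lambda>b. g (idx b) b"] by blast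
  have "h x = g i x" if "x \<in> W i" for i x
  proof (rule endo.linear_eq_on[OF h(1) lin])
    show "x \<in> span (B i)" using that B by blast
    show "h b = g i b" if "b \<in> B i" for b
      using h(2)[of b] that uniq idx[of b] by (metis UN_iff UNIV_I)
  qed
  then show ?thesis using h by blast
qed

end

text \<open>The degree \<open>n\<close> part is read as the union of the \<open>F p n\<close>, so
  exhaustiveness is built in. The same axioms hold for the image of a projection, which is how
  \<open>F'\<close> and \<open>V\<close> are treated below.\<close>

locale filtered_space = linear_space scale
  for scale :: "'k::field \<Rightarrow> 'a::ab_group_add \<Rightarrow> 'a" +
  fixes F :: "int \<Rightarrow> int \<Rightarrow> 'a set"
  assumes F_subspace: "subspace (F p n)"
    and F_decreasing: "F (p + 1) n \<subseteq> F p n"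
    and F_bounded: "\<exists>l. F l n = {0}"
    and F_direct: "direct_family (\<lambda>n. \<Union>p. F p n)"
begin

interpretation endo: vector_space_pair scale scale
  by unfold_locales

lemma F_antimono: "p \<le> q \<Longrightarrow> F q n \<subseteq> F p n"
proof (induction q rule: int_ge_induct)
  case (step q)
  then show ?case using F_decreasing[of q n] by blast
qed simp

text \<open>A choice of representatives of the associated graded pieces.\<close>

definition splitting :: "(int \<Rightarrow> int \<Rightarrow> 'a set) \<Rightarrow> bool" where
  "splitting W \<longleftrightarrow> (\<forall>p n. subspace (W p n) \<and> W p n \<subseteq> F p n \<and> W p n \<inter> F (p + 1) n \<subseteq> {0} \<and>
     (\<forall>v\<in>F p n. \<exists>w\<in>W p n. \<exists>s\<in>F (p + 1) n. v = w + s))"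

lemma splitting_subset: "splitting W \<Longrightarrow> W p n \<subseteq> F p n"
  unfolding splitting_def by blast

lemma ex_splitting: "\<exists>W. splitting W"
  using complement[OF F_subspace F_subspace F_decreasing]
  by (intro exI[of _ "\<lambda>p n. complement (F (p + 1) n) (F p n)"]) (simp add: splitting_def)

text \<open>Descending induction on \<open>p\<close> from an index \<open>l\<close> where the
  filtration in degree \<open>n\<close> is zero; every step adds one graded piece.\<close>

lemma splitting_span:
  assumes "splitting W"
  shows "span (\<Union>p'\<in>{p..}. W p' n) = F p n"
proof
  show "span (\<Union>p'\<in>{p..}. W p' n) \<subseteq> F p n"
    using assms F_antimono unfolding splitting_def
    by (intro span_minimal F_subspace) fastforce
  obtain l where l: "F l n = {0}" using F_bounded by blast
  show "F p n \<subseteq> span (\<Union>p'\<in>{p..}. W p' n)"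
  proof (cases "p \<le> l")
    case True
    then show ?thesis
    proof (induction p rule: int_le_induct)
      case base
      show ?case by (simp add: l span_zero)
    next
      case (step p)
      have mono: "span (\<Union>p'\<in>{p..}. W p' n) \<subseteq> span (\<Union>p'\<in>{p - 1..}. W p' n)"
        by (intro span_mono UN_mono) auto
      show ?case
      proof
        fix v assume "v \<in> F (p - 1) n"
        then obtain w s where "w \<in> W (p - 1) n" "s \<in> F (p - 1 + 1) n" "v = w + s"
          using assms unfolding splitting_def by blast
        moreover from this have "w \<in> span (\<Union>p'\<in>{p - 1..}. W p' n)"
          by (intro span_base) auto
        ultimately show "v \<in> span (\<Union>p'\<in>{p - 1..}. W p' n)"
          using step mono by (auto intro!: span_add)
      qed
    qed
  next
    case False
    then show ?thesis using F_antimono[of l p n] l span_zero by auto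
  qed
qed

text \<open>Reduces claims about a linear map on \<open>F p n\<close> to the representatives of the
  graded pieces.\<close>

lemma splitting_induct:
  assumes "splitting W" "lin g" "subspace S" "\<And>p' w. p \<le> p' \<Longrightarrow> w \<in> W p' n \<Longrightarrow> g w \<in> S" "x \<in> F p n"
  shows "g x \<in> S"
proof -
  have "span (\<Union>p'\<in>{p..}. W p' n) \<subseteq> {x. g x \<in> S}"
    using assms(4) by (intro span_minimal endo.linear_subspace_linear_preimage assms) auto
  then show ?thesis using splitting_span[OF assms(1)] assms(5) by blast
qed

lemma splitting_direct:
  assumes "splitting W"
  shows "direct_family (\<lambda>(p, n). W p n)"
  unfolding direct_family_def
proof (intro allI impI ballI)
  fix I x i
  assume I: "finite I" "\<forall>i\<in>I. x i \<in> (case i of (p, n) \<Rightarrow> W p n)" "sum x I = 0" "i \<in> I"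
  have W: "x (p, n) \<in> W p n" if "(p, n) \<in> I" for p n using I(2) that by auto
  \<comment> \<open>The sum is separated in two stages: degrees by \<open>F_direct\<close>, then
    filtration indices within one degree by looking at the lowest term.\<close>
  let ?y = "\<lambda>n. \<Sum>i\<in>{i \<in> I. snd i = n}. x i"
  have "sum ?y (snd ` I) = 0" using sum.image_gen[OF I(1), of x snd] I(3) by simp
  moreover have "?y n \<in> (\<Union>p. F p n)" for n
  proof
    let ?m = "Min (fst ` I)"
    show "?y n \<in> F ?m n"
    proof (rule subspace_sum[OF F_subspace])
      fix i assume i: "i \<in> {i \<in> I. snd i = n}"
      then have "x i \<in> F (fst i) n"
        using W[of "fst i" n] splitting_subset[OF assms, of "fst i" n] by (metis (mono_tags, lifting) mem_Collect_eq prod.collapse subsetD)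
      moreover have "?m \<le> fst i" using i I(1) by auto
      ultimately show "x i \<in> F ?m n" using F_antimono by blast
    qed
  qed simp
  ultimately have y: "?y n = 0" if "n \<in> snd ` I" for n
    using that I(1) by (intro direct_familyD[OF F_direct, of "snd ` I" ?y]) auto
  \<comment> \<open>The summand of smallest index \<open>q\<close> is minus the sum of the others,
    which lies in \<open>F (q + 1) n\<close>; as \<open>W q n\<close> meets that space only in 0, it
    vanishes.\<close>
  have z: "\<forall>p\<in>P. z p = 0" if "finite P" "\<forall>p\<in>P. z p \<in> W p n" "sum z P = 0" for P z n
    using that
  proof (induction P rule: finite_linorder_min_induct)
    case (insert q P)
    have "sum z P \<in> F (q + 1) n"
    proof (rule subspace_sum[OF F_subspace])
      fix p assume "p \<in> P"
      then have "z p \<in> F p n" "q + 1 \<le> p"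
        using insert splitting_subset[OF assms, of p n] by auto
      then show "z p \<in> F (q + 1) n" using F_antimono by blast
    qed
    moreover have q: "z q = - sum z P"
      using insert.hyps insert.prems(2) by (subst (asm) sum.insert) (auto simp add: eq_neg_iff_add_eq_0)
    ultimately have "z q \<in> F (q + 1) n" by (simp add: subspace_neg[OF F_subspace])
    then have "z q = 0"
      using insert.prems assms unfolding splitting_def by blast
    then show ?case using q insert by auto
  qed simp
  obtain p n where i: "i = (p, n)" by force
  have "\<forall>p\<in>fst ` {i \<in> I. snd i = n}. x (p, n) = 0"
  proof (rule z)
    have "(\<Sum>p\<in>fst ` {i \<in> I. snd i = n}. x (p, n)) = ?y n"
      by (subst sum.reindex) (auto simp: inj_on_def intro: sum.cong)
    then show "(\<Sum>p\<in>fst ` {i \<in> I. snd i = n}. x (p, n)) = 0"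
      using y[of n] I(4) i by force
  qed (use I(1) W in auto)
  then show "x i = 0" using I(4) by (force simp: i)
qed

end

section \<open>Contractions of filtered complexes\<close>

definition homotopy_proj :: "('a::ab_group_add \<Rightarrow> 'a) \<Rightarrow> ('a \<Rightarrow> 'a) \<Rightarrow> 'a \<Rightarrow> 'a" where
  "homotopy_proj d h x = x - d (h x) - h (d x)"

lemma direct_family_mono:
  assumes "direct_family G" "\<And>i. G' i \<subseteq> G i"
  shows "direct_family G'"
  using assms unfolding direct_family_def by (meson subsetD)

locale filtered_complex = filtered_space scale F
  for scale :: "'k::field \<Rightarrow> 'a::ab_group_add \<Rightarrow> 'a" and F +
  fixes d :: "'a \<Rightarrow> 'a"
  assumes d_lin: "lin d"
    and d_d: "d (d x) = 0"
    and d_F: "x \<in> F p n \<Longrightarrow> d x \<in> F p (n + 1)"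
begin

interpretation endo: vector_space_pair scale scale
  by unfold_locales

definition contraction :: "int \<Rightarrow> ('a \<Rightarrow> 'a) \<Rightarrow> bool" where
  "contraction r h \<longleftrightarrow> lin h \<and> (\<forall>p n. \<forall>x\<in>F p n. h x \<in> F (p - r) (n - 1) \<and> homotopy_proj d h x \<in> F p n \<and>
     d (homotopy_proj d h x) \<in> F (p + r + 1) (n + 1) \<and> h (homotopy_proj d h x) = 0)"

lemma lin_homotopy_proj: "lin h \<Longrightarrow> lin (homotopy_proj d h)"
  unfolding homotopy_proj_def[abs_def]
  by (rule lin_diff[OF lin_diff[OF lin_ident lin_compose[OF d_lin]] lin_compose[OF _ d_lin]])

lemma d_homotopy_proj: "lin h \<Longrightarrow> d (homotopy_proj d h x) = homotopy_proj d h (d x)"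
  by (simp add: homotopy_proj_def endo.linear_diff[OF d_lin] d_d endo.linear_0)

text \<open>\<open>h\<close> vanishes on the projection of \<open>x\<close> and, since the
  projection commutes with \<open>d\<close>, also on the differential of that element, so both
  correction terms are 0.\<close>

lemma homotopy_proj_idem:
  assumes "contraction r h" "x \<in> F p n"
  shows "homotopy_proj d h (homotopy_proj d h x) = homotopy_proj d h x"
proof -
  have "h (homotopy_proj d h x) = 0" "h (homotopy_proj d h (d x)) = 0"
    using assms d_F unfolding contraction_def by blast+
  moreover have "lin h" using assms unfolding contraction_def by blast
  ultimately show ?thesis
    by (simp add: homotopy_proj_def[of d h "homotopy_proj d h x"] d_homotopy_proj endo.linear_0[OF d_lin])
qed

text \<open>Each graded piece of the filtration splits as \<open>K \<oplus> N \<oplus> d K\<close>, where \<open>d\<close> is injective on \<open>K\<close>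
  modulo higher filtration and raises the filtration on \<open>N\<close>; the homotopy inverts \<open>d\<close> on \<open>d K\<close>.\<close>
lemma ex_contraction_0: "\<exists>h. contraction 0 h"
proof -
  \<comment> \<open>\<open>Z p n\<close> consists of the vectors whose class in the associated
    graded is a cycle. Below, \<open>K\<close> complements the cycles and \<open>N\<close>
    complements the boundaries among the cycles, so \<open>N\<close> represents the homology of the
    associated graded complex.\<close>
  define Z where "Z p n = F p n \<inter> {x. d x \<in> F (p + 1) (n + 1)}" for p n
  have Z_sub: "subspace (Z p n)" for p n
    unfolding Z_def
    by (intro subspace_inter F_subspace endo.linear_subspace_linear_preimage d_lin)
  have F_Z: "F (p + 1) n \<subseteq> Z p n" for p n
    using F_decreasing d_F unfolding Z_def by blast
  define K where "K p n = complement (Z p n) (F p n)" for p n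
  have "Z p n \<subseteq> F p n" for p n by (auto simp: Z_def)
  note K = complement[OF Z_sub F_subspace this, folded K_def]
  have dK_sub: "subspace (d ` K p n)" for p n
    by (intro endo.linear_subspace_image d_lin K)
  have dK_Z: "d k \<in> Z p n" if "k \<in> K p (n - 1)" for k p n
    using d_F[of k p "n - 1"] K(2) that subspace_0[OF F_subspace] by (auto simp: Z_def d_d)
  \<comment> \<open>Adding \<open>F (p + 1) n\<close> to the boundaries makes the complement
    \<open>N\<close> of \<open>S\<close> in \<open>Z\<close> meet the higher filtration only in
    0.\<close>
  define S where "S p n = {x + y |x y. x \<in> d ` K p (n - 1) \<and> y \<in> F (p + 1) n}" for p n
  have S_sub: "subspace (S p n)" for p n
    unfolding S_def by (intro subspace_sums dK_sub F_subspace)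
  have S_Z: "S p n \<subseteq> Z p n" for p n
    unfolding S_def using dK_Z F_Z[of p n] by (auto intro!: subspace_add[OF Z_sub])
  define N where "N p n = complement (S p n) (Z p n)" for p n
  note N = complement[OF S_sub Z_sub S_Z, folded N_def]
  define X where "X p n = {x + y |x y. x \<in> K p n \<and> y \<in> N p n}" for p n
  define W where "W p n = {x + y |x y. x \<in> X p n \<and> y \<in> d ` K p (n - 1)}" for p n
  have X_sub: "subspace (X p n)" for p n
    unfolding X_def by (intro subspace_sums K N)
  have W_sub: "subspace (W p n)" for p n
    unfolding W_def by (intro subspace_sums X_sub dK_sub)
  have W_E: "\<exists>k\<in>K p n. \<exists>m\<in>N p n. \<exists>k'\<in>K p (n - 1). x = k + m + d k'" if "x \<in> W p n" for x p n
    using that unfolding W_def X_def by blast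
  \<comment> \<open>The components vanish one after the other: \<open>k\<close> lies in
    \<open>Z\<close>, then \<open>m\<close> lies in \<open>S\<close>, and then \<open>d k'\<close>
    in \<open>F (p + 1) n\<close> puts \<open>k'\<close> into \<open>Z\<close>; each complement
    meets the respective space only in 0.\<close>
  have indep: "k = 0 \<and> m = 0 \<and> k' = 0"
    if "k \<in> K p n" "m \<in> N p n" "k' \<in> K p (n - 1)" "k + m + d k' \<in> F (p + 1) n" for k m k' p n
  proof -
    have "k = (k + m + d k') - m - d k'" by simp
    also have "\<dots> \<in> Z p n"
      using that N(2)[of p n] dK_Z F_Z[of p n] by (intro subspace_diff[OF Z_sub]) auto
    finally have k: "k = 0" using that K(3) by blast
    have "m = d (- k') + (k + m + d k')" by (simp add: k endo.linear_neg[OF d_lin])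
    also have "\<dots> \<in> S p n"
      using that(3,4) subspace_neg[OF K(1)] unfolding S_def by blast
    finally have m: "m = 0" using that N(3) by blast
    have "k' \<in> Z p (n - 1)" using that(3,4) K(2) k m unfolding Z_def by auto
    then show ?thesis using that(3) K(3) k m by blast
  qed
  have W_F: "W p n \<subseteq> F p n" for p n
  proof
    fix x assume "x \<in> W p n"
    then obtain k m k' where "k \<in> K p n" "m \<in> N p n" "k' \<in> K p (n - 1)" "x = k + m + d k'"
      using W_E by blast
    then show "x \<in> F p n"
      using K(2)[of p n] N(2)[of p n] dK_Z[of k' p n] unfolding Z_def by (auto intro!: subspace_add[OF F_subspace])
  qed
  have split: "splitting W"
    unfolding splitting_def
  proof (intro allI conjI ballI W_sub W_F)
    fix p n
    show "W p n \<inter> F (p + 1) n \<subseteq> {0}"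
    proof
      fix x assume x: "x \<in> W p n \<inter> F (p + 1) n"
      then obtain k m k' where "k \<in> K p n" "m \<in> N p n" "k' \<in> K p (n - 1)" "x = k + m + d k'"
        using W_E by blast
      then show "x \<in> {0}" using indep[of k p n m k'] x by (simp add: endo.linear_0[OF d_lin])
    qed
    fix v assume "v \<in> F p n"
    then obtain k z where kz: "k \<in> K p n" "z \<in> Z p n" "v = k + z" using K(4) by blast
    then obtain m s where ms: "m \<in> N p n" "s \<in> S p n" "z = m + s" using N(4) by blast
    then obtain y s' where "y \<in> d ` K p (n - 1)" "s' \<in> F (p + 1) n" "s = y + s'" unfolding S_def by blast
    moreover from this kz ms have "k + m + y \<in> W p n" unfolding W_def X_def by blast
    ultimately show "\<exists>w\<in>W p n. \<exists>s\<in>F (p + 1) n. v = w + s"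
      using kz ms by (metis add.assoc)
  qed
  \<comment> \<open>The homotopy on one graded piece: project to \<open>d K\<close> along
    \<open>K + N\<close> and invert \<open>d\<close>, which is injective on
    \<open>K\<close>.\<close>
  have "\<exists>g. lin g \<and> (\<forall>k\<in>K p n. \<forall>m\<in>N p n. \<forall>k'\<in>K p (n - 1). g (k + m + d k') = k')" for p n
  proof -
    have "X p n \<inter> d ` K p (n - 1) \<subseteq> {0}"
    proof
      fix x assume "x \<in> X p n \<inter> d ` K p (n - 1)"
      then obtain k m k' where *: "k \<in> K p n" "m \<in> N p n" "k' \<in> K p (n - 1)" "x = k + m" "x = d k'"
        unfolding X_def by blast
      then have "k + m + d (- k') = 0" by (simp add: endo.linear_neg[OF d_lin])
      then have "k = 0 \<and> m = 0"
        using indep[of k p n m "- k'"] * subspace_neg[OF K(1) *(3)] subspace_0[OF F_subspace, of "p + 1" n] by simp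
      then show "x \<in> {0}" using * by simp
    qed
    from ex_projection_along[OF X_sub dK_sub this] obtain e
      where e: "lin e" "\<And>x. x \<in> X p n \<Longrightarrow> e x = 0" "\<And>y. y \<in> d ` K p (n - 1) \<Longrightarrow> e y = y"
      by blast
    have "inj_on d (K p (n - 1))"
    proof (subst endo.linear_inj_on_iff_eq_0[OF d_lin K(1)], intro ballI impI)
      fix k assume "k \<in> K p (n - 1)" "d k = 0"
      then show "k = 0"
        using indep[of 0 p n 0 k] subspace_0[OF K(1)] subspace_0[OF N(1)] subspace_0[OF F_subspace] by simp
    qed
    from endo.linear_exists_left_inverse_on[OF d_lin K(1) this]
    obtain g where g: "lin g" "\<And>k. k \<in> K p (n - 1) \<Longrightarrow> g (d k) = k"
      by blast
    have "g (e (k + m + d k')) = k'" if "k \<in> K p n" "m \<in> N p n" "k' \<in> K p (n - 1)" for k m k'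
    proof -
      have "e (k + m + d k') = d k'"
        using that e(2)[of "k + m"] e(3)[of "d k'"] unfolding X_def
        by (subst endo.linear_add[OF e(1)]) auto
      then show ?thesis using that g by simp
    qed
    then show ?thesis using lin_compose[OF g(1) e(1)] by blast
  qed
  then have "\<forall>p. \<exists>g. \<forall>n. lin (g n) \<and>
      (\<forall>k\<in>K p n. \<forall>m\<in>N p n. \<forall>k'\<in>K p (n - 1). g n (k + m + d k') = k')"
    by (intro allI choice)
  from choice[OF this] obtain g where g: "\<And>p n. lin (g p n)"
    "\<And>p n k m k'. k \<in> K p n \<Longrightarrow> m \<in> N p n \<Longrightarrow> k' \<in> K p (n - 1) \<Longrightarrow> g p n (k + m + d k') = k'"
    by blast
  have "\<exists>h. lin h \<and> (\<forall>i. \<forall>x\<in>(case i of (p, n) \<Rightarrow> W p n). h x = (case i of (p, n) \<Rightarrow> g p n) x)"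
    by (rule ex_linear_on_direct_family[OF splitting_direct[OF split]])
       (auto simp: W_sub g split: prod.split)
  then obtain h where lin: "lin h" and h_g: "\<And>p n x. x \<in> W p n \<Longrightarrow> h x = g p n x"
    by (metis (no_types, lifting) case_prod_conv)
  have h: "h (k + m + d k') = k'" if "k \<in> K p n" "m \<in> N p n" "k' \<in> K p (n - 1)" for k m k' p n
  proof -
    have "k + m + d k' \<in> W p n" using that unfolding W_def X_def by blast
    then show ?thesis using h_g g(2)[OF that] by simp
  qed
  have h_K: "h k = 0" "h (d k) = k" if "k \<in> K p n" for k p n
    using h[of k p n 0 0] h[of 0 p "n + 1" 0 k] that subspace_0[OF K(1)] subspace_0[OF N(1)]
    by (simp_all add: endo.linear_0[OF d_lin])
  have h_N: "h m = 0" if "m \<in> N p n" for m p n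
    using h[of 0 p n m 0] that subspace_0[OF K(1)] by (simp add: endo.linear_0[OF d_lin])
  have h_F: "h x \<in> F p (n - 1)" if "x \<in> F p n" for x p n
  proof (rule splitting_induct[OF split lin F_subspace _ that])
    fix p' w assume "p \<le> p'" "w \<in> W p' n"
    then obtain k m k' where *: "k \<in> K p' n" "m \<in> N p' n" "k' \<in> K p' (n - 1)" "w = k + m + d k'"
      using W_E by blast
    then have "h w \<in> F p' (n - 1)" using h[OF *(1-3)] K(2) by auto
    then show "h w \<in> F p (n - 1)" using F_antimono[OF \<open>p \<le> p'\<close>] by blast
  qed
  \<comment> \<open>On the splitting, \<open>h\<close> takes values in the spaces \<open>K\<close>,
    where it vanishes. This yields \<open>h (P x) = 0\<close>, because \<open>P\<close> subtracts
    \<open>h (d m)\<close> from \<open>m\<close>.\<close>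
  have h_h: "h (h x) = 0" if "x \<in> F p n" for x p n
  proof -
    have "h (h x) \<in> {0}"
    proof (rule splitting_induct[OF split lin_compose[OF lin lin] subspace_single_0 _ that])
      fix p' w assume "w \<in> W p' n"
      then obtain k m k' where *: "k \<in> K p' n" "m \<in> N p' n" "k' \<in> K p' (n - 1)" "w = k + m + d k'"
        using W_E by blast
      then show "h (h w) \<in> {0}" using h[OF *(1-3)] h_K(1)[OF *(3)] by simp
    qed
    then show ?thesis by simp
  qed
  let ?P = "homotopy_proj d h"
  have P_lin: "lin ?P" by (rule lin_homotopy_proj[OF lin])
  \<comment> \<open>\<open>P\<close> kills \<open>K\<close> and \<open>d K\<close>, and changes a
    vector \<open>m\<close> of \<open>N\<close> only by \<open>h (d m)\<close>, which lies one
    filtration step higher.\<close>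
  have P_W: "\<exists>m\<in>N p n. ?P w = m - h (d m)" if w: "w \<in> W p n" for w p n
  proof -
    obtain k m k' where *: "k \<in> K p n" "m \<in> N p n" "k' \<in> K p (n - 1)" "w = k + m + d k'"
      using W_E[OF w] by blast
    then have "?P w = m - h (d m)"
      by (simp add: endo.linear_add[OF P_lin])
         (simp add: homotopy_proj_def h_K h_N d_d endo.linear_0[OF d_lin] endo.linear_0[OF lin])
    then show ?thesis using * by blast
  qed
  have N_F: "m \<in> F p n" "d m \<in> F (p + 1) (n + 1)" "h (d m) \<in> F (p + 1) n" if "m \<in> N p n" for m p n
    using that N(2) h_F[of "d m" "p + 1" "n + 1"] unfolding Z_def by auto
  have "contraction 0 h"
    unfolding contraction_def
  proof (intro conjI allI ballI lin)
    fix p n x assume x: "x \<in> F p n"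
    show "h x \<in> F (p - 0) (n - 1)" using h_F x by simp
    show "?P x \<in> F p n"
    proof (rule splitting_induct[OF split P_lin F_subspace _ x])
      fix p' w assume *: "p \<le> p'" "w \<in> W p' n"
      then obtain m where m: "m \<in> N p' n" "?P w = m - h (d m)" using P_W by blast
      then have "?P w \<in> F p' n"
        using N_F[OF m(1)] F_decreasing by (auto intro!: subspace_diff[OF F_subspace])
      then show "?P w \<in> F p n" using F_antimono * by blast
    qed
    have "d (?P x) \<in> F (p + 1) (n + 1)"
    proof (rule splitting_induct[OF split lin_compose[OF d_lin P_lin] F_subspace _ x])
      fix p' w assume *: "p \<le> p'" "w \<in> W p' n"
      then obtain m where m: "m \<in> N p' n" "?P w = m - h (d m)" using P_W by blast
      then have "d (?P w) \<in> F (p' + 1) (n + 1)"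
        using N_F[OF m(1)] d_F by (auto simp: endo.linear_diff[OF d_lin] intro!: subspace_diff[OF F_subspace])
      then show "d (?P w) \<in> F (p + 1) (n + 1)" using F_antimono[of "p + 1" "p' + 1"] * by auto
    qed
    then show "d (?P x) \<in> F (p + 0 + 1) (n + 1)" by simp
    have "h (?P x) \<in> {0}"
    proof (rule splitting_induct[OF split lin_compose[OF lin P_lin] subspace_single_0 _ x])
      fix p' w assume *: "p \<le> p'" "w \<in> W p' n"
      then obtain m where m: "m \<in> N p' n" "?P w = m - h (d m)" using P_W by blast
      then show "h (?P w) \<in> {0}"
        using N_F[OF m(1)] h_h h_N by (auto simp: endo.linear_diff[OF lin])
    qed
    then show "h (?P x) = 0" by simp
  qed
  then show ?thesis by blast
qed

end

text \<open>The image of a contraction, refiltered so that its differential, which raises the filtration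
  by \<open>r + 1\<close>, becomes filtration preserving, is contracted once more.\<close>
lemma (in filtered_complex) ex_contraction: "\<exists>h. contraction (int r) h"
proof (induction r)
  case 0
  then show ?case using ex_contraction_0 by simp
next
  case (Suc r)
  then obtain h where h: "contraction (int r) h" by blast
  interpret endo: vector_space_pair scale scale by unfold_locales
  let ?P = "homotopy_proj d h"
  let ?r = "int r + 1"
  have h_lin: "lin h"
    and hF: "\<And>p n x. x \<in> F p n \<Longrightarrow> h x \<in> F (p - int r) (n - 1)"
    and PF: "\<And>p n x. x \<in> F p n \<Longrightarrow> ?P x \<in> F p n"
    and dPF: "\<And>p n x. x \<in> F p n \<Longrightarrow> d (?P x) \<in> F (p + int r + 1) (n + 1)"
    and hP: "\<And>p n x. x \<in> F p n \<Longrightarrow> h (?P x) = 0"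
    using h unfolding contraction_def by blast+
  have PP: "?P (?P x) = ?P x" if "x \<in> F p n" for x p n
    using homotopy_proj_idem[OF h that] .
  have P_lin: "lin ?P" by (rule lin_homotopy_proj[OF h_lin])
  \<comment> \<open>The shift by \<open>(r + 1) * n\<close> in degree \<open>n\<close> compensates
    the gain of \<open>r + 1\<close> under \<open>d\<close>, so that \<open>d\<close> preserves
    \<open>F'\<close>.\<close>
  define F' where "F' p n = ?P ` F (p + ?r * n) n" for p n
  have F'_F: "F' p n \<subseteq> F (p + ?r * n) n" for p n using PF unfolding F'_def by blast
  interpret F': filtered_complex scale F' d
  proof (intro filtered_complex.intro filtered_space.intro linear_space_axioms
      filtered_space_axioms.intro filtered_complex_axioms.intro)
    fix p n
    show "subspace (F' p n)"
      unfolding F'_def by (intro endo.linear_subspace_image P_lin F_subspace)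
    show "F' (p + 1) n \<subseteq> F' p n"
      unfolding F'_def by (intro image_mono F_antimono) simp
    obtain l where "F l n = {0}" using F_bounded by blast
    then have "F' (l - ?r * n) n = {0}" unfolding F'_def by (simp add: endo.linear_0[OF P_lin])
    then show "\<exists>l. F' l n = {0}" by blast
    show "direct_family (\<lambda>n. \<Union>p. F' p n)"
      using F'_F by (intro direct_family_mono[OF F_direct]) blast
    show "lin d" by (rule d_lin)
    show "d (d x) = 0" for x by (rule d_d)
    fix x assume "x \<in> F' p n"
    then obtain y where y: "y \<in> F (p + ?r * n) n" "x = ?P y" unfolding F'_def by blast
    \<comment> \<open>Writing \<open>d x\<close> as a value of \<open>P\<close> keeps it inside the
      image on which \<open>F'\<close> lives.\<close>
    have "d x = ?P (d (?P y))"
      using PP[OF y(1)] y(2) by (simp add: d_homotopy_proj[OF h_lin, symmetric])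
    moreover have "d (?P y) \<in> F (p + ?r * (n + 1)) (n + 1)"
      using dPF[OF y(1)] by (simp add: algebra_simps)
    ultimately show "d x \<in> F' p (n + 1)" unfolding F'_def by blast
  qed
  obtain h' where h': "F'.contraction 0 h'" using F'.ex_contraction_0 by blast
  let ?P' = "homotopy_proj d h'"
  have h'_lin: "lin h'"
    and h'F: "\<And>p n x. x \<in> F' p n \<Longrightarrow> h' x \<in> F' p (n - 1)"
    and P'F: "\<And>p n x. x \<in> F' p n \<Longrightarrow> ?P' x \<in> F' p n"
    and dP'F: "\<And>p n x. x \<in> F' p n \<Longrightarrow> d (?P' x) \<in> F' (p + 1) (n + 1)"
    and hP': "\<And>p n x. x \<in> F' p n \<Longrightarrow> h' (?P' x) = 0"
    using h' by (auto simp: F'.contraction_def)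
  \<comment> \<open>\<open>h'\<close> is controlled only on the image of \<open>P\<close>, hence the
    composition. The projection belonging to \<open>k\<close> is the composite of the two
    projections, as \<open>Q\<close> shows.\<close>
  define k where "k x = h x + h' (?P x)" for x
  let ?Q = "homotopy_proj d k"
  have Q: "?Q x = ?P' (?P x)" for x
  proof -
    have e: "u - (a + b) - (c + e) = (u - a - c) - b - e" for u a b c e :: 'a
      by (simp add: algebra_simps)
    have "?Q x = x - (d (h x) + d (h' (?P x))) - (h (d x) + h' (?P (d x)))"
      by (simp only: homotopy_proj_def[of d k] k_def endo.linear_add[OF d_lin])
    also have "\<dots> = ?P x - d (h' (?P x)) - h' (?P (d x))"
      unfolding e homotopy_proj_def[of d h x, symmetric] ..
    also have "\<dots> = ?P' (?P x)"
      by (simp only: homotopy_proj_def[of d h' "?P x"] d_homotopy_proj[OF h_lin])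
    finally show ?thesis .
  qed
  have "contraction (int (Suc r)) k"
    unfolding contraction_def
  proof (intro conjI allI ballI)
    show "lin k"
      using lin_add[OF h_lin lin_compose[OF h'_lin P_lin]] by (simp add: k_def[abs_def])
    fix p n x assume x: "x \<in> F p n"
    then have Px: "?P x \<in> F' (p - ?r * n) n" unfolding F'_def by auto
    \<comment> \<open>\<open>h'\<close> keeps the index of \<open>F'\<close> but lowers the degree
      by one, so measured in \<open>F\<close> it loses at most \<open>r + 1\<close>.\<close>
    have "h' (?P x) \<in> F (p - ?r * n + ?r * (n - 1)) (n - 1)" using h'F[OF Px] F'_F by blast
    then have "h' (?P x) \<in> F (p - int (Suc r)) (n - 1)" by (simp add: algebra_simps)
    moreover have "h x \<in> F (p - int (Suc r)) (n - 1)"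
      using hF[OF x] F_antimono[of "p - int (Suc r)" "p - int r"] by auto
    ultimately show "k x \<in> F (p - int (Suc r)) (n - 1)"
      unfolding k_def by (intro subspace_add[OF F_subspace])
    have Qx: "?Q x \<in> F' (p - ?r * n) n" using P'F[OF Px] by (simp add: Q)
    then show "?Q x \<in> F p n" using F'_F[of "p - ?r * n" n] by simp blast
    \<comment> \<open>One step gained in \<open>F'\<close> and \<open>r + 1\<close> from the change
      of degree together give the gain \<open>r + 2\<close>.\<close>
    have "d (?Q x) \<in> F (p - ?r * n + 1 + ?r * (n + 1)) (n + 1)"
      unfolding Q using dP'F[OF Px] F'_F by blast
    then show "d (?Q x) \<in> F (p + int (Suc r) + 1) (n + 1)" by (simp add: algebra_simps)
    obtain y where y: "y \<in> F p n" "?Q x = ?P y" using Qx unfolding F'_def by (simp add: image_iff) blast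
    have "h' (?P (?Q x)) = h' (?Q x)" using PP[OF y(1)] y(2) by simp
    also have "\<dots> = 0" using hP'[OF Px] by (simp add: Q)
    finally show "k (?Q x) = 0" using hP[OF y(1)] y(2) by (simp add: k_def)
  qed
  then show ?case by blast
qed

section \<open>Filtration degrees and signs of the transferred structure\<close>

lemma ksign_add: "ksign (a + b) = ksign a * ksign b"
  by (simp add: ksign_def)

lemma ksign_cong: "even (a - b) \<Longrightarrow> ksign a = ksign b"
  by (auto simp: ksign_def)

lemma homog_Nil [simp]: "homog G ns [] \<longleftrightarrow> ns = []"
  by (auto simp: homog_def)

lemma homog_Cons: "homog G ns (x # xs) \<longleftrightarrow> (\<exists>n ns'. ns = n # ns' \<and> x \<in> G n \<and> homog G ns' xs)"
proof (cases ns)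
  case (Cons n ns')
  then show ?thesis
    by (auto simp: homog_def nth_Cons split: nat.splits)
qed (simp add: homog_def)

lemma homog_append: "homog G ns (xs @ ys) \<longleftrightarrow> (\<exists>a b. ns = a @ b \<and> homog G a xs \<and> homog G b ys)"
proof (induction xs arbitrary: ns)
  case (Cons x xs)
  show ?case
  proof
    assume "homog G ns ((x # xs) @ ys)"
    then obtain n a b where "ns = (n # a) @ b" "x \<in> G n" "homog G a xs" "homog G b ys"
      unfolding append_Cons homog_Cons Cons.IH by auto
    then show "\<exists>a b. ns = a @ b \<and> homog G a (x # xs) \<and> homog G b ys"
      unfolding homog_Cons by blast
  next
    assume "\<exists>a b. ns = a @ b \<and> homog G a (x # xs) \<and> homog G b ys"
    then show "homog G ns ((x # xs) @ ys)"
      unfolding append_Cons homog_Cons Cons.IH by fastforce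
  qed
qed simp

lemma homog_take: "homog G ns xs \<Longrightarrow> homog G (take k ns) (take k xs)"
  and homog_drop: "homog G ns xs \<Longrightarrow> homog G (drop k ns) (drop k xs)"
  by (auto simp: homog_def)

lemma homog_length: "homog G ns xs \<Longrightarrow> length xs = length ns"
  by (simp add: homog_def)

text \<open>The exponent of the sign by which \<open>sgl\<close> acts on a word with these degrees,
  see \<open>multilinear_sgl_G\<close>.\<close>

fun reversal_sign :: "int list \<Rightarrow> int" where
  "reversal_sign [] = 0"
| "reversal_sign (n # ns) = int (length ns) * n + reversal_sign ns"

lemma reversal_sign_append:
  "reversal_sign (a @ b) = reversal_sign a + int (length b) * sum_list a + reversal_sign b"
  by (induction a) (simp_all add: algebra_simps)

lemma finite_compositions: "finite (compositions n)"
proof (rule finite_subset)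
  have "length is \<le> sum_list is" if "set is \<subseteq> {1..n}" for "is"
    using that by (induction "is") auto
  then show "compositions n \<subseteq> {is. set is \<subseteq> {1..n} \<and> length is \<le> n}"
    unfolding compositions_def by fastforce
qed (simp add: finite_lists_length_le)

text \<open>\<open>sg\<close> multiplies by the sign of the degree. Being a linear involution of the
  whole type, it replaces the Koszul signs, so the dg-algebra axioms can be stated for arbitrary
  elements, as \<open>bar_transfer\<close> demands.\<close>

locale filtered_transfer = filtered_complex scale F d
  for scale :: "'k::field \<Rightarrow> 'a::ab_group_add \<Rightarrow> 'a" and F d +
  fixes G :: "int \<Rightarrow> 'a set" and mu :: "'a \<Rightarrow> 'a \<Rightarrow> 'a" and sg h :: "'a \<Rightarrow> 'a" and r :: nat
  assumes G_eq: "G n = (\<Union>p. F p n)"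
    and G_subspace: "subspace (G n)"
    and sg_lin: "lin sg"
    and sg_sg: "sg (sg x) = x"
    and sg_G: "x \<in> G n \<Longrightarrow> sg x = scale (ksign n) x"
    and d_sg: "d (sg x) = - sg (d x)"
    and h_sg: "h (sg x) = - sg (h x)"
    and mu_lin_left: "lin (\<lambda>x. mu x y)"
    and mu_lin_right: "lin (mu x)"
    and sg_mu: "sg (mu x y) = mu (sg x) (sg y)"
    and d_mu: "d (mu x y) = mu (d x) y + mu (sg x) (d y)"
    and mu_assoc: "mu (mu x y) z = mu x (mu y z)"
    and mu_F: "x \<in> F p i \<Longrightarrow> y \<in> F q j \<Longrightarrow> mu x y \<in> F (p + q) (i + j)"
    and contr: "contraction (int r) h"
begin

interpretation endo: vector_space_pair scale scale
  by unfold_locales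

abbreviation "P \<equiv> homotopy_proj d h"

lemma h_lin: "lin h"
  and h_F: "x \<in> F p n \<Longrightarrow> h x \<in> F (p - int r) (n - 1)"
  and P_F: "x \<in> F p n \<Longrightarrow> P x \<in> F p n"
  and d_P_F: "x \<in> F p n \<Longrightarrow> d (P x) \<in> F (p + int r + 1) (n + 1)"
  using contr unfolding contraction_def by blast+

lemma P_P: "x \<in> F p n \<Longrightarrow> P (P x) = P x"
  using homotopy_proj_idem[OF contr] .

lemma P_lin: "lin P"
  by (rule lin_homotopy_proj[OF h_lin])

lemma sg_F: "x \<in> F p n \<Longrightarrow> sg x \<in> F p n"
  using sg_G[of x n] subspace_scale[OF F_subspace] unfolding G_eq by fastforce

text \<open>\<open>- sg\<close> is the sign of the suspended degree, and \<open>mu (sg x) y\<close>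
  is the suspended product.\<close>

sublocale bar: bar_transfer scale d h "\<lambda>x. - sg x" "\<lambda>x. mu (sg x)"
proof
  note lin = lin_iff[THEN iffD1, rule_format]
  fix c x y z x' y'
  show "d (scale c x + y) = scale c (d x) + d y" by (rule lin[OF d_lin])
  show "h (scale c x + y) = scale c (h x) + h y" by (rule lin[OF h_lin])
  show "- sg (scale c x + y) = scale c (- sg x) + - sg y" by (simp add: lin[OF sg_lin])
  show "mu (sg (scale c x + x')) y = scale c (mu (sg x) y) + mu (sg x') y"
    by (simp add: lin[OF sg_lin] lin[OF mu_lin_left])
  show "mu (sg x) (scale c y + y') = scale c (mu (sg x) y) + mu (sg x) y'" by (rule lin[OF mu_lin_right])
  note neg = endo.linear_neg[OF sg_lin] endo.linear_neg[OF d_lin] endo.linear_neg[OF h_lin]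
    endo.linear_neg[OF mu_lin_right] endo.linear_neg[OF mu_lin_left]
  show "- sg (- sg x) = x" by (simp add: neg sg_sg)
  show "d (- sg x) = - (- sg (d x))" by (simp add: neg d_sg)
  show "h (- sg x) = - (- sg (h x))" by (simp add: neg h_sg)
  show "- sg (mu (sg x) y) = - mu (sg (- sg x)) (- sg y)" by (simp add: neg sg_sg sg_mu)
  show "d (d x) = 0" by (rule d_d)
  show "d (mu (sg x) y) = - mu (sg (d x)) y - mu (sg (- sg x)) (d y)"
    by (simp add: neg sg_sg d_mu d_sg)
  show "mu (sg (mu (sg x) y)) z + mu (sg (- sg x)) (mu (sg y) z) = 0"
    by (simp add: neg sg_sg sg_mu mu_assoc)
qed

section \<open>Filtration degrees of the transferred maps\<close>

definition flist :: "int list \<Rightarrow> int list \<Rightarrow> 'a list \<Rightarrow> bool" where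
  "flist ps ns xs \<longleftrightarrow> length ps = length xs \<and> length ns = length xs \<and> (\<forall>i<length xs. xs ! i \<in> F (ps ! i) (ns ! i))"

lemma flist_take: "flist ps ns xs \<Longrightarrow> flist (take k ps) (take k ns) (take k xs)"
  and flist_drop: "flist ps ns xs \<Longrightarrow> flist (drop k ps) (drop k ns) (drop k xs)"
  by (auto simp: flist_def)

text \<open>The shifts \<open>(1 - i) * r\<close> and \<open>(1 - j) * r\<close> of the two factors
  add up to \<open>(2 - n) * r\<close> for \<open>n = i + j\<close>, and the outer \<open>h\<close>
  loses another \<open>r\<close>.\<close>

lemma tmor_tprod_F:
  assumes "flist ps ns xs" "xs \<noteq> []"
  shows "bar.tmor xs \<in> F (sum_list ps + (1 - int (length xs)) * int r) (sum_list ns + 1 - int (length xs)) \<and>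
    bar.tprod xs \<in> F (sum_list ps + (2 - int (length xs)) * int r) (sum_list ns + 2 - int (length xs))"
  using assms
proof (induction "length xs" arbitrary: xs ps ns rule: less_induct)
  case less
  let ?s = "int (length xs)"
  let ?p = "sum_list ps + (2 - ?s) * int r" and ?n = "sum_list ns + 2 - ?s"
  have "mu (sg (bar.tmor (take k xs))) (bar.tmor (drop k xs)) \<in> F ?p ?n" if "k \<le> length xs" for k
  proof (cases "k = 0 \<or> k = length xs")
    case True
    then show ?thesis by (auto simp: subspace_0[OF F_subspace] intro!: subspace_0[OF F_subspace])
  next
    case False
    let ?u = "take k xs" and ?v = "drop k xs"
    have l: "length ?u < length xs" "length ?v < length xs" "?u \<noteq> []" "?v \<noteq> []"
      using that False less(3) by auto
    have "bar.tmor ?u \<in> F (sum_list (take k ps) + (1 - int (length ?u)) * int r) (sum_list (take k ns) + 1 - int (length ?u))"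
      "bar.tmor ?v \<in> F (sum_list (drop k ps) + (1 - int (length ?v)) * int r) (sum_list (drop k ns) + 1 - int (length ?v))"
      using less(1)[OF l(1) flist_take[OF less(2)] l(3)] less(1)[OF l(2) flist_drop[OF less(2)] l(4)] by blast+
    then have "mu (sg (bar.tmor ?u)) (bar.tmor ?v)
        \<in> F (sum_list (take k ps) + (1 - int (length ?u)) * int r + (sum_list (drop k ps) + (1 - int (length ?v)) * int r))
            (sum_list (take k ns) + 1 - int (length ?u) + (sum_list (drop k ns) + 1 - int (length ?v)))"
      by (intro mu_F sg_F)
    also have "sum_list (take k ps) + (1 - int (length ?u)) * int r + (sum_list (drop k ps) + (1 - int (length ?v)) * int r) = ?p"
      using sum_list_append[of "take k ps" "drop k ps"] that by (simp add: of_nat_diff algebra_simps)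
    also have "sum_list (take k ns) + 1 - int (length ?u) + (sum_list (drop k ns) + 1 - int (length ?v)) = ?n"
      using sum_list_append[of "take k ns" "drop k ns"] that by (simp add: of_nat_diff algebra_simps)
    finally show ?thesis .
  qed
  then have prod: "bar.tprod xs \<in> F ?p ?n"
    unfolding bar.tprod_def split_sum_conv_sum by (intro subspace_sum[OF F_subspace]) auto
  moreover have "bar.tmor xs \<in> F (sum_list ps + (1 - ?s) * int r) (sum_list ns + 1 - ?s)"
  proof (cases "length xs = 1")
    case True
    then obtain x p n where "xs = [x]" "ps = [p]" "ns = [n]"
      using less(2) unfolding flist_def by (metis length_0_conv length_Suc_conv One_nat_def)
    then show ?thesis using less(2) by (simp add: flist_def)
  next
    case False
    have "- h (bar.tprod xs) \<in> F (?p - int r) (?n - 1)"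
      by (intro subspace_neg[OF F_subspace] h_F prod)
    moreover have "?p - int r = sum_list ps + (1 - ?s) * int r" "?n - 1 = sum_list ns + 1 - ?s"
      by (simp_all add: algebra_simps)
    ultimately show ?thesis using False by (subst bar.tmor_eq) simp
  qed
  ultimately show ?case by blast
qed

text \<open>Homogeneity fixes only degrees; filtration indices are chosen letter by letter. The
  second family \<open>F'\<close> allows letters to be taken from \<open>V\<close>.\<close>

lemma homog_flist:
  assumes "homog H ns xs" "\<And>n x. x \<in> H n \<Longrightarrow> \<exists>p. x \<in> F' p n \<and> x \<in> F p n"
  shows "\<exists>ps. flist ps ns xs \<and> (\<forall>i<length xs. xs ! i \<in> F' (ps ! i) (ns ! i))"
proof -
  have "\<forall>i. \<exists>p. i < length xs \<longrightarrow> xs ! i \<in> F' p (ns ! i) \<and> xs ! i \<in> F p (ns ! i)"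
    using assms unfolding homog_def by blast
  then obtain p where "\<And>i. i < length xs \<Longrightarrow> xs ! i \<in> F' (p i) (ns ! i) \<and> xs ! i \<in> F (p i) (ns ! i)" by metis
  then show ?thesis
    using assms(1) by (intro exI[of _ "map p [0..<length xs]"]) (auto simp: flist_def homog_def)
qed

lemma tmor_G:
  assumes "homog G ns xs" "xs \<noteq> []"
  shows "bar.tmor xs \<in> G (sum_list ns + 1 - int (length xs))"
  using homog_flist[OF assms(1), of F] tmor_tprod_F[OF _ assms(2)] unfolding G_eq by blast

lemma tprod_G:
  assumes "homog G ns xs" "xs \<noteq> []"
  shows "bar.tprod xs \<in> G (sum_list ns + 2 - int (length xs))"
  using homog_flist[OF assms(1), of F] tmor_tprod_F[OF _ assms(2)] unfolding G_eq by blast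

lemma tbar_cases:
  assumes "xs \<noteq> []"
  obtains x where "xs = [x]" "bar.tbar xs = d x" | "length xs \<ge> 2" "bar.tbar xs = P (bar.tprod xs)"
proof (cases "length xs \<ge> 2")
  case True
  then show ?thesis using that(2) by (simp add: bar.tbar_eq homotopy_proj_def)
next
  case False
  then obtain x where "xs = [x]" using assms by (cases xs) (auto simp: not_le less_Suc_eq numeral_2_eq_2)
  then show ?thesis using that(1) by simp
qed

lemma tbar_G:
  assumes "homog G ns xs" "xs \<noteq> []"
  shows "bar.tbar xs \<in> G (sum_list ns + 2 - int (length xs))"
  using assms(2)
proof (cases rule: tbar_cases)
  case (1 x)
  then obtain n p where "ns = [n]" "x \<in> F p n"
    using assms(1) by (auto simp: homog_Cons G_eq)
  then show ?thesis using 1 d_F[of x p n] by (auto simp: G_eq add.commute)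
next
  case 2
  then show ?thesis using tprod_G[OF assms] P_F unfolding G_eq by auto
qed

text \<open>Keller's operations differ from the bar operations by the sign \<open>(-1)^(\<Sum>j. (n - j) * |x_j|)\<close>.\<close>
fun sgl :: "'a list \<Rightarrow> 'a list" where
  "sgl [] = []"
| "sgl (x # xs) = (sg ^^ length xs) x # sgl xs"

lemma sg_funpow_G: "x \<in> G n \<Longrightarrow> (sg ^^ k) x = scale (ksign (int k * n)) x"
proof (induction k)
  case 0
  then show ?case by (simp add: ksign_def)
next
  case (Suc k)
  then show ?case
    by (simp add: endo.linear_scale[OF sg_lin] sg_G ksign_add distrib_right)
qed

lemma multilinear_sgl_G:
  "bar.multilinear T \<Longrightarrow> homog G ns xs \<Longrightarrow> T (sgl xs) = scale (ksign (reversal_sign ns)) (T xs)"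
proof (induction xs arbitrary: T ns)
  case Nil
  then show ?case by (simp add: ksign_def)
next
  case (Cons x xs)
  then obtain n ns' where ns: "ns = n # ns'" "x \<in> G n" "homog G ns' xs" by (auto simp: homog_Cons)
  have "T (sgl (x # xs)) = T ([] @ scale (ksign (int (length xs) * n)) x # sgl xs)"
    by (simp add: sg_funpow_G[OF ns(2)])
  also have "\<dots> = scale (ksign (int (length xs) * n)) (T (x # sgl xs))"
    by (subst bar.multilinear_scale[OF Cons.prems(1)]) simp
  also have "T (x # sgl xs) = scale (ksign (reversal_sign ns')) (T (x # xs))"
    by (rule Cons.IH[OF bar.multilinear_Cons[OF Cons.prems(1)] ns(3)])
  finally show ?case by (simp add: ns homog_length[OF ns(3)] ksign_add)
qed

lemma multilinear_map_t_G:
  "bar.multilinear T \<Longrightarrow> homog G ns xs \<Longrightarrow>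
     T (map (\<lambda>x. - sg x) xs @ ys) = scale (ksign (int (length xs) + sum_list ns)) (T (xs @ ys))"
proof (induction xs arbitrary: T ns)
  case Nil
  then show ?case by (simp add: ksign_def)
next
  case (Cons x xs)
  then obtain n ns' where ns: "ns = n # ns'" "x \<in> G n" "homog G ns' xs" by (auto simp: homog_Cons)
  have "- sg x = scale (ksign (1 + n)) x"
    by (simp add: sg_G[OF ns(2)] ksign_add ksign_def)
  then have "T (map (\<lambda>x. - sg x) (x # xs) @ ys) = T ([] @ scale (ksign (1 + n)) x # map (\<lambda>x. - sg x) xs @ ys)"
    by simp
  also have "\<dots> = scale (ksign (1 + n)) (T (x # map (\<lambda>x. - sg x) xs @ ys))"
    by (subst bar.multilinear_scale[OF Cons.prems(1)]) simp
  also have "T (x # map (\<lambda>x. - sg x) xs @ ys) = scale (ksign (int (length xs) + sum_list ns')) (T (x # xs @ ys))"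
    by (rule Cons.IH[OF bar.multilinear_Cons[OF Cons.prems(1)] ns(3)])
  finally show ?case by (simp add: ns ksign_add[symmetric] algebra_simps)
qed

text \<open>Translates Keller's insertion sum into the bar form: term by term the signs differ by a
  factor that depends only on the degrees of the word, so it comes out of the whole sum.\<close>

lemma insert_op_sum_sgl:
  assumes T: "bar.multilinear T" and hom: "homog G ns xs"
  shows "insert_op_sum scale (\<lambda>s ys. T (sgl ys)) (\<lambda>s ys. bar.tbar (sgl ys)) scale ns xs
    = scale (ksign (reversal_sign ns)) (bar.bar_insert T xs)"
proof -
  let ?n = "length xs" and ?t = "\<lambda>x. - sg x"
  have len: "length ns = ?n" using homog_length[OF hom] by simp
  have "scale (ksign (int k + int s * int (?n - k - s) + int s * sum_list (take k ns)))
          (T (sgl (take k xs @ [bar.tbar (sgl (take s (drop k xs)))] @ drop (k + s) xs)))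
      = scale (ksign (reversal_sign ns))
          (T (map ?t (take k xs) @ [bar.tbar (take s (drop k xs))] @ drop (k + s) xs))"
    if "k \<le> ?n" "1 \<le> s" "s \<le> ?n - k" for k s
  proof -
    define u v w where "u = take k xs" "v = take s (drop k xs)" "w = drop (k + s) xs"
    define a b c where "a = take k ns" "b = take s (drop k ns)" "c = drop (k + s) ns"
    have hu: "homog G a u" "homog G b v" "homog G c w"
      unfolding u_v_w_def a_b_c_def using hom by (auto intro: homog_take homog_drop)
    have lu: "length u = k" "length v = s" "length w = ?n - k - s" "length c = length w" "length b = s"
      using that len by (auto simp: u_v_w_def a_b_c_def)
    have ns: "ns = a @ b @ c"
      unfolding a_b_c_def by (metis append_take_drop_id drop_drop add.commute)
    have v0: "v \<noteq> []" using lu that by auto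
    define D where "D = sum_list b + 2 - int s"
    have tv: "bar.tbar v \<in> G D" using tbar_G[OF hu(2) v0] lu by (simp add: D_def)
    have tsv: "bar.tbar (sgl v) = scale (ksign (reversal_sign b)) (bar.tbar v)"
      by (rule multilinear_sgl_G[OF bar.multilinear_tbar hu(2)])
    then have "bar.tbar (sgl v) \<in> G D" using tv by (simp add: subspace_scale[OF G_subspace])
    then have "homog G (a @ [D] @ c) (u @ [bar.tbar (sgl v)] @ w)"
      using hu by (auto simp: homog_append homog_Cons)
    then have "T (sgl (u @ [bar.tbar (sgl v)] @ w))
        = scale (ksign (reversal_sign (a @ [D] @ c))) (T (u @ [bar.tbar (sgl v)] @ w))"
      by (rule multilinear_sgl_G[OF T])
    also have "T (u @ [bar.tbar (sgl v)] @ w) = scale (ksign (reversal_sign b)) (T (u @ bar.tbar v # w))"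
      using bar.multilinear_scale[OF T, of u _ "bar.tbar v" w] by (simp add: tsv)
    finally have l: "T (sgl (u @ [bar.tbar (sgl v)] @ w))
        = scale (ksign (reversal_sign (a @ [D] @ c) + reversal_sign b)) (T (u @ bar.tbar v # w))"
      by (simp add: ksign_add)
    have r: "T (map ?t u @ [bar.tbar v] @ w) = scale (ksign (int k + sum_list a)) (T (u @ bar.tbar v # w))"
      using multilinear_map_t_G[OF T hu(1), of "bar.tbar v # w"] lu by simp
    \<comment> \<open>Modulo 2, the exponent \<open>s * (n - k - s)\<close> of Keller's sign cancels
      against the shift \<open>2 - s\<close> in the degree \<open>D\<close> of the inserted letter,
      which counts once for every letter behind it.\<close>
    have "ksign (int k + int s * int (?n - k - s) + int s * sum_list a + (reversal_sign (a @ [D] @ c) + reversal_sign b))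
      = (ksign (reversal_sign ns + (int k + sum_list a)) :: 'k)"
      by (rule ksign_cong) (simp add: ns reversal_sign_append lu D_def algebra_simps)
    then show ?thesis
      unfolding u_v_w_def[symmetric] a_b_c_def(1)[symmetric] l r
      by (simp add: ksign_add[symmetric] add.assoc)
  qed
  then show ?thesis
    unfolding insert_op_sum_def Let_def insert_sum_conv_sum scale_sum_right
    by (intro sum.cong refl) auto
qed

text \<open>The target is a dg-algebra, so only compositions with one or two parts contribute; they
  give \<open>d (tmor xs)\<close> and the cuts in \<open>tprod\<close>. The primed maps leave room
  for structure maps that agree with \<open>d\<close> and \<open>mu\<close> on homogeneous elements
  only.\<close>

lemma comp_sum_sgl:
  assumes hom: "homog G ns xs" and ne: "xs \<noteq> []"
    and d': "\<And>n x. x \<in> G n \<Longrightarrow> d' x = d x"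
    and mu': "\<And>p q x y. x \<in> G p \<Longrightarrow> y \<in> G q \<Longrightarrow> mu' x y = mu x y"
  shows "comp_sum scale (dga_ainf d' mu') (\<lambda>s ys. bar.tmor (sgl ys)) ns xs
    = scale (ksign (reversal_sign ns)) (d (bar.tmor xs) + bar.tprod xs)"
proof -
  let ?n = "length xs"
  have n: "?n \<ge> 1" using ne by (cases xs) auto
  let ?term = "\<lambda>is. scale (ksign ((\<Sum>j<length is. int (length is - 1 - j) * (int (is ! j) - 1))
                     + (\<Sum>j<length is. (1 - int (is ! j)) * sum_list (take (sum_list (take j is)) ns))))
          (dga_ainf d' mu' (length is) (map (\<lambda>j. bar.tmor (sgl (block is j xs))) [0..<length is]))"
  let ?C = "insert [?n] ((\<lambda>k. [k, ?n - k]) ` {1..<?n})"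
  have sub: "?C \<subseteq> compositions ?n"
    using n by (auto simp: compositions_def)
  have rest: "?term is = 0" if "is \<in> compositions ?n - ?C" for "is"
  proof -
    have "length is \<noteq> 1"
    proof
      assume "length is = 1"
      then obtain a where "is = [a]" by (metis length_0_conv length_Suc_conv One_nat_def)
      then show False using that by (auto simp: compositions_def)
    qed
    moreover have "length is \<noteq> 2"
    proof
      assume "length is = 2"
      then obtain a b where ab: "is = [a, b]"
        by (metis length_0_conv length_Suc_conv numeral_2_eq_2)
      then have "a + b = ?n" "1 \<le> a" "1 \<le> b" using that by (auto simp: compositions_def)
      then have "is \<in> ?C" using ab by (auto intro!: image_eqI[of _ _ a])
      then show False using that by blast
    qed
    ultimately show ?thesis by (simp add: dga_ainf_def)
  qed
  have tG: "bar.tmor xs \<in> G (sum_list ns + 1 - int ?n)" by (rule tmor_G[OF hom ne])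
  have one: "?term [?n] = scale (ksign (reversal_sign ns)) (d (bar.tmor xs))"
  proof -
    have "d' (bar.tmor (sgl xs)) = d (scale (ksign (reversal_sign ns)) (bar.tmor xs))"
      unfolding multilinear_sgl_G[OF bar.multilinear_tmor hom]
      by (rule d'[OF subspace_scale[OF G_subspace tG]])
    then show ?thesis
      by (simp add: dga_ainf_def block_def endo.linear_scale[OF d_lin]) (simp add: ksign_def)
  qed
  have two: "?term [k, ?n - k]
      = scale (ksign (reversal_sign ns)) (mu (sg (bar.tmor (take k xs))) (bar.tmor (drop k xs)))"
    if k: "k \<in> {1..<?n}" for k
  proof -
    define u v where "u = take k xs" "v = drop k xs"
    define a b where "a = take k ns" "b = drop k ns"
    have hu: "homog G a u" "homog G b v"
      unfolding u_v_def a_b_def using hom by (auto intro: homog_take homog_drop)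
    have lu: "length u = k" "length v = ?n - k" "length b = ?n - k"
      using k homog_length[OF hom] by (auto simp: u_v_def a_b_def)
    have ns: "ns = a @ b" by (simp add: a_b_def)
    have ne': "u \<noteq> []" "v \<noteq> []" using k lu by auto
    have G: "bar.tmor u \<in> G (sum_list a + 1 - int k)" "bar.tmor v \<in> G (sum_list b + 1 - int (?n - k))"
      using tmor_G[OF hu(1) ne'(1)] tmor_G[OF hu(2) ne'(2)] lu by auto
    have s: "bar.tmor (sgl u) = scale (ksign (reversal_sign a)) (bar.tmor u)"
      "bar.tmor (sgl v) = scale (ksign (reversal_sign b)) (bar.tmor v)"
      using multilinear_sgl_G[OF bar.multilinear_tmor] hu by blast+
    have "mu' (bar.tmor (sgl u)) (bar.tmor (sgl v))
        = mu (scale (ksign (reversal_sign a)) (bar.tmor u)) (scale (ksign (reversal_sign b)) (bar.tmor v))"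
      unfolding s by (rule mu'[OF subspace_scale[OF G_subspace G(1)] subspace_scale[OF G_subspace G(2)]])
    also have "\<dots> = scale (ksign (reversal_sign a + reversal_sign b)) (mu (bar.tmor u) (bar.tmor v))"
      by (simp add: endo.linear_scale[OF mu_lin_left] endo.linear_scale[OF mu_lin_right] ksign_add mult.commute)
    finally have m: "mu' (bar.tmor (sgl u)) (bar.tmor (sgl v))
      = scale (ksign (reversal_sign a + reversal_sign b)) (mu (bar.tmor u) (bar.tmor v))" .
    have "?term [k, ?n - k] = scale (ksign (int k - 1 + (1 - int (?n - k)) * sum_list a))
        (mu' (bar.tmor (sgl u)) (bar.tmor (sgl v)))"
      using k by (simp add: dga_ainf_def block_def u_v_def a_b_def numeral_2_eq_2 lessThan_Suc)
    also have "\<dots> = scale (ksign (int k - 1 + (1 - int (?n - k)) * sum_list a + (reversal_sign a + reversal_sign b)))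
        (mu (bar.tmor u) (bar.tmor v))"
      unfolding m by (simp add: ksign_add)
    \<comment> \<open>The surplus \<open>sum_list a + 1 - k\<close> is the degree of
      \<open>tmor u\<close>; it produces the \<open>sg\<close> in the suspended product.\<close>
    also have "ksign (int k - 1 + (1 - int (?n - k)) * sum_list a + (reversal_sign a + reversal_sign b))
        = (ksign (reversal_sign ns + (sum_list a + 1 - int k)) :: 'k)"
    proof (rule ksign_cong)
      have "int k - 1 + (1 - int (?n - k)) * sum_list a + (reversal_sign a + reversal_sign b)
          - (reversal_sign ns + (sum_list a + 1 - int k))
        = 2 * (int k - 1 - int (?n - k) * sum_list a)"
        by (simp only: ns reversal_sign_append lu) (simp add: algebra_simps)
      then show "even (int k - 1 + (1 - int (?n - k)) * sum_list a + (reversal_sign a + reversal_sign b)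
          - (reversal_sign ns + (sum_list a + 1 - int k)))" by (simp only: dvd_triv_left)
    qed
    also have "scale (ksign (reversal_sign ns + (sum_list a + 1 - int k))) (mu (bar.tmor u) (bar.tmor v))
        = scale (ksign (reversal_sign ns)) (mu (sg (bar.tmor u)) (bar.tmor v))"
      by (simp add: ksign_add sg_G[OF G(1)] endo.linear_scale[OF mu_lin_left])
    finally show ?thesis by (simp add: u_v_def)
  qed
  have "comp_sum scale (dga_ainf d' mu') (\<lambda>s ys. bar.tmor (sgl ys)) ns xs = sum ?term (compositions ?n)"
    by (simp add: comp_sum_def)
  also have "\<dots> = sum ?term ?C"
    by (rule sum.mono_neutral_right[OF finite_compositions sub]) (use rest in blast)
  also have "\<dots> = ?term [?n] + (\<Sum>k\<in>{1..<?n}. ?term [k, ?n - k])"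
    by (subst sum.insert) (auto simp: sum.reindex inj_on_def simp del: length_Cons)
  also have "(\<Sum>k\<in>{1..<?n}. ?term [k, ?n - k])
      = (\<Sum>k\<in>{1..<?n}. scale (ksign (reversal_sign ns)) (mu (sg (bar.tmor (take k xs))) (bar.tmor (drop k xs))))"
    by (rule sum.cong[OF refl two])
  also have "\<dots> = scale (ksign (reversal_sign ns)) (bar.tprod xs)"
  proof -
    have "bar.tprod xs = (\<Sum>k\<in>{1..<?n}. mu (sg (bar.tmor (take k xs))) (bar.tmor (drop k xs)))"
      unfolding bar.tprod_def split_sum_conv_sum
      by (rule sum.mono_neutral_right) (auto simp: not_less Suc_le_eq)
    then show ?thesis by (simp add: scale_sum_right)
  qed
  finally show ?thesis by (simp only: one scale_right_distrib)
qed

text \<open>The power of \<open>sg\<close> at a position depends only on the number of letters after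
  it, so changing one letter leaves the other entries fixed.\<close>

lemma multilinear_sgl:
  assumes "bar.multilinear T"
  shows "bar.multilinear (\<lambda>ys. T (sgl ys))"
  unfolding bar.multilinear_def
proof (intro allI)
  fix pre post c u v
  have "\<exists>pre'. \<forall>y. sgl (pre @ y # post) = pre' @ (sg ^^ length post) y # sgl post"
  proof (induction pre)
    case (Cons x pre)
    then obtain pre' where "\<forall>y. sgl (pre @ y # post) = pre' @ (sg ^^ length post) y # sgl post" by blast
    then show ?case by (intro exI[of _ "(sg ^^ (length pre + Suc (length post))) x # pre'"]) simp
  qed (rule exI[of _ "[]"], simp)
  then obtain pre' where pre': "\<And>y. sgl (pre @ y # post) = pre' @ (sg ^^ length post) y # sgl post" by blast
  have "(sg ^^ k) (scale c u + v) = scale c ((sg ^^ k) u) + (sg ^^ k) v" for k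
    by (induction k) (simp_all add: lin_iff[THEN iffD1, rule_format, OF sg_lin])
  then show "T (sgl (pre @ (scale c u + v) # post)) = scale c (T (sgl (pre @ u # post))) + T (sgl (pre @ v # post))"
    using bar.multilinearD[OF assms] by (simp add: pre')
qed

lemma multilinear_update:
  assumes "bar.multilinear T" "i < length xs"
  shows "T (xs[i := scale c u + v]) = scale c (T (xs[i := u])) + T (xs[i := v])"
  using bar.multilinearD[OF assms(1), of "take i xs" c u v "drop (Suc i) xs"] assms(2)
  by (simp add: upd_conv_take_nth_drop)

end

section \<open>The minimal model\<close>

context filtered_transfer
begin

interpretation endo: vector_space_pair scale scale
  by unfold_locales

section \<open>The image of the projection as a filtered complex\<close>

definition V :: "int \<Rightarrow> int \<Rightarrow> 'a set" where
  "V p n = P ` F p n"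

lemma V_F: "V p n \<subseteq> F p n"
  using P_F unfolding V_def by blast

lemma F_G: "F p n \<subseteq> G n"
  unfolding G_eq by blast

lemma P_V: "x \<in> F p n \<Longrightarrow> P x \<in> V p n"
  unfolding V_def by blast

lemma P_V_id: "x \<in> V p n \<Longrightarrow> P x = x"
  unfolding V_def using P_P by blast

lemma d_V: "x \<in> V p n \<Longrightarrow> d x \<in> V (p + int r + 1) (n + 1)"
proof -
  assume x: "x \<in> V p n"
  then have "d x = P (d x)" using P_V_id[OF x] d_homotopy_proj[OF h_lin, of x] by simp
  moreover have "d x \<in> F (p + int r + 1) (n + 1)"
    using d_P_F[of x p n] x V_F[of p n] P_V_id[OF x] by auto
  ultimately show ?thesis using P_V[of "d x"] by metis
qed

sublocale V: filtered_space scale V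
proof (intro filtered_space.intro linear_space_axioms filtered_space_axioms.intro)
  fix p n
  show "subspace (V p n)"
    unfolding V_def by (intro endo.linear_subspace_image P_lin F_subspace)
  show "V (p + 1) n \<subseteq> V p n"
    unfolding V_def by (intro image_mono F_decreasing)
  obtain l where "F l n = {0}" using F_bounded by blast
  then show "\<exists>l. V l n = {0}"
    unfolding V_def by (intro exI[of _ l]) (simp add: endo.linear_0[OF P_lin])
  show "direct_family (\<lambda>n. \<Union>p. V p n)"
    using V_F by (intro direct_family_mono[OF F_direct]) blast
qed

lemma tbar_V:
  assumes "flist ps ns xs" "length xs \<ge> 2"
  shows "bar.tbar xs \<in> V (sum_list ps + (2 - int (length xs)) * int r) (sum_list ns + 2 - int (length xs))"
proof -
  have ne: "xs \<noteq> []" using assms by auto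
  then show ?thesis
    using tmor_tprod_F[OF assms(1) ne] P_V assms(2) by (cases rule: tbar_cases) auto
qed

section \<open>Comparison of the spectral sequence pages\<close>

lemma Zr_V: "Zr d V k p n \<subseteq> Zr d F k p n"
  using V_F unfolding Zr_def by blast

lemma Nr_V: "Nr d V k p n \<subseteq> Nr d F k p n"
  using Zr_V unfolding Nr_def by blast

lemma Zr_P: "x \<in> Zr d F k p n \<Longrightarrow> P x \<in> Zr d V k p n"
  by (simp add: Zr_def d_homotopy_proj[OF h_lin] P_V)

lemma Nr_P:
  assumes "x \<in> Nr d F k p n"
  shows "P x \<in> Nr d V k p n"
proof -
  obtain y z where "y \<in> Zr d F (k - 1) (p + 1) n" "z \<in> Zr d F (k - 1) (p - k + 1) (n - 1)" "x = y + d z"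
    using assms unfolding Nr_def by blast
  then have "P x = P y + d (P z)" "P y \<in> Zr d V (k - 1) (p + 1) n" "P z \<in> Zr d V (k - 1) (p - k + 1) (n - 1)"
    by (simp_all add: Zr_P endo.linear_add[OF P_lin] d_homotopy_proj[OF h_lin])
  then show ?thesis unfolding Nr_def by blast
qed

text \<open>The inverse on homology is induced by \<open>P\<close>, which commutes with
  \<open>d\<close> and preserves the filtration; surjectivity comes from
  \<open>1 - P = d h + h d\<close> and the bound \<open>r\<close> on the loss of filtration under
  \<open>h\<close>.\<close>

lemma Er_quasi_iso_V: "Er_quasi_iso d V d F (\<lambda>x. x) (int r)"
  unfolding Er_quasi_iso_def
proof (intro conjI allI ballI impI)
  let ?r = "int r"
  fix p n
  show "(\<lambda>x. x) ` Zr d V ?r p n \<subseteq> Zr d F ?r p n" using Zr_V by simp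
  show "(\<lambda>x. x) ` Nr d V ?r p n \<subseteq> Nr d F ?r p n" using Nr_V by simp
  have zero_Z: "0 \<in> Zr d F k q m" for k q m
    by (simp add: Zr_def subspace_0[OF F_subspace] endo.linear_0[OF d_lin])
  have "0 \<in> Nr d F ?r q m" for q m
    unfolding Nr_def mem_Collect_eq
    by (intro exI[of _ 0] conjI zero_Z) (simp add: endo.linear_0[OF d_lin])
  then show "d x - d x \<in> Nr d F ?r (p + ?r) (n + 1)" for x by simp
  note F_add = subspace_add[OF F_subspace] and F_diff = subspace_diff[OF F_subspace]
  show "\<exists>x\<in>Er_cyc d V ?r p n. Er_hzero d F ?r p n (y - x)" if "y \<in> Er_cyc d F ?r p n" for y
  proof
    have y: "y \<in> F p n" "d y \<in> F (p + ?r) (n + 1)" "d y \<in> Nr d F ?r (p + ?r) (n + 1)"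
      using that unfolding Er_cyc_def Zr_def by auto
    show "P y \<in> Er_cyc d V ?r p n"
      using Zr_P[of y ?r p n] Nr_P[OF y(3)] y by (simp add: Er_cyc_def Zr_def d_homotopy_proj[OF h_lin])
    \<comment> \<open>The class of \<open>d y\<close> is zero on the page: \<open>d y\<close> is a
      term of higher filtration plus the differential of an element of filtration
      \<open>p + 1\<close>.\<close>
    obtain a z where a: "a \<in> F (p + ?r + 1) (n + 1)" "d a \<in> F (p + 2 * ?r) (n + 2)"
      and z: "z \<in> F (p + 1) n" "d z \<in> F (p + ?r) (n + 1)" and dy: "d y = a + d z"
      using y(3) unfolding Nr_def Zr_def by (auto simp: algebra_simps)
    \<comment> \<open>\<open>h y\<close> bounds \<open>y - P y\<close> modulo \<open>Nr\<close>:
      what remains is \<open>h (d y) = h a + h (d z)\<close>, and the homotopy formula at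
      \<open>z\<close> turns \<open>h (d z)\<close> into \<open>z - P z - d (h z)\<close>.\<close>
    have "h y \<in> Zr d F ?r (p - ?r) (n - 1)"
    proof -
      have "d (h y) = y - P y - h (d y)" by (simp add: homotopy_proj_def)
      also have "\<dots> \<in> F p n"
        using y h_F[OF y(2)] by (intro F_diff P_F) auto
      finally show ?thesis using h_F[OF y(1)] by (simp add: Zr_def)
    qed
    moreover have "y - P y - d (h y) \<in> Nr d F ?r p n"
    proof -
      have ha: "h a \<in> F (p + 1) n" using h_F[OF a(1)] by (simp add: algebra_simps)
      have "d (h a) = a - P a - h (d a)" by (simp add: homotopy_proj_def)
      also have "\<dots> \<in> F (p + ?r) (n + 1)"
        using a(1) F_decreasing[of "p + ?r" "n + 1"] h_F[OF a(2)]
        by (intro F_diff P_F) (auto simp: algebra_simps)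
      finally have dha: "d (h a) \<in> F (p + ?r) (n + 1)" .
      have "d (h z) = z - P z - h (d z)" by (simp add: homotopy_proj_def)
      also have "\<dots> \<in> F p n"
        using z(1) F_decreasing[of p n] h_F[OF z(2)] by (intro F_diff P_F) (auto simp: algebra_simps)
      finally have dhz: "d (h z) \<in> F p n" .
      have "h a + z - P z \<in> Zr d F (?r - 1) (p + 1) n"
        using ha z P_F[OF z(1)] P_F[OF z(2)] dha unfolding Zr_def
        by (simp add: endo.linear_add[OF d_lin] endo.linear_diff[OF d_lin] d_homotopy_proj[OF h_lin] F_add F_diff)
      moreover have "- h z \<in> Zr d F (?r - 1) (p - ?r + 1) (n - 1)"
        using h_F[OF z(1)] dhz subspace_neg[OF F_subspace] unfolding Zr_def
        by (simp add: endo.linear_neg[OF d_lin] algebra_simps)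
      moreover have "y - P y - d (h y) = (h a + z - P z) + d (- h z)"
      proof -
        have "y - P y - d (h y) = h (d y)" by (simp add: homotopy_proj_def)
        also have "\<dots> = h a + h (d z)" by (simp add: dy endo.linear_add[OF h_lin])
        also have "h (d z) = z - P z + d (- h z)" by (simp add: homotopy_proj_def endo.linear_neg[OF d_lin])
        finally show ?thesis by (simp add: algebra_simps)
      qed
      ultimately show ?thesis unfolding Nr_def by blast
    qed
    ultimately show "Er_hzero d F ?r p n (y - P y)" unfolding Er_hzero_def by blast
  qed
  \<comment> \<open>For injectivity, \<open>P\<close> fixes \<open>x\<close> and carries a bounding
    element in \<open>F\<close> to one in \<open>V\<close>.\<close>
  show "Er_hzero d V ?r p n x" if x: "x \<in> Er_cyc d V ?r p n" and hz: "Er_hzero d F ?r p n x" for x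
  proof -
    obtain z where z: "z \<in> Zr d F ?r (p - ?r) (n - 1)" "x - d z \<in> Nr d F ?r p n"
      using hz unfolding Er_hzero_def by blast
    have "P x = x" using x P_V_id unfolding Er_cyc_def Zr_def by blast
    then have "x - d (P z) \<in> Nr d V ?r p n"
      using Nr_P[OF z(2)] by (simp add: endo.linear_diff[OF P_lin] d_homotopy_proj[OF h_lin])
    then show ?thesis using Zr_P[OF z(1)] unfolding Er_hzero_def by blast
  qed
qed

text \<open>The pages evaluate the differential only on elements of \<open>F\<close>, so the
  globally linear \<open>d\<close> may be exchanged for the given \<open>d'\<close>.\<close>

lemma Er_quasi_iso_cong:
  assumes "\<And>p n x. x \<in> F p n \<Longrightarrow> d' x = d x"
  shows "Er_quasi_iso d V d' F (\<lambda>x. x) k \<longleftrightarrow> Er_quasi_iso d V d F (\<lambda>x. x) k"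
proof -
  have Z: "Zr d' F k p n = Zr d F k p n" for k p n using assms unfolding Zr_def by auto
  have dz: "d' z = d z" if "z \<in> Zr d F k p n" for z k p n using assms that unfolding Zr_def by auto
  have N: "Nr d' F k p n = Nr d F k p n" for k p n
    unfolding Nr_def Z
    by (intro Collect_cong ex_cong1) (auto simp: dz[of _ "k - 1" "p - k + 1" "n - 1"])
  have C: "Er_cyc d' F k p n = Er_cyc d F k p n" for k p n
    unfolding Er_cyc_def Z N by (auto simp: dz[of _ k p n])
  have H: "Er_hzero d' F k p n x \<longleftrightarrow> Er_hzero d F k p n x" for k p n x
    unfolding Er_hzero_def Z N by (intro bex_cong refl) (simp add: dz[of _ k "p - k" "n - 1"])
  have B: "(\<forall>x\<in>Zr d V k p n. d' x - d x \<in> S) \<longleftrightarrow> (\<forall>x\<in>Zr d V k p n. d x - d x \<in> S)" for p n S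
    using dz[of _ k p n] Zr_V[of k p n] by (intro ball_cong refl) (auto dest!: subsetD)
  show ?thesis unfolding Er_quasi_iso_def Z N C H B ..
qed

theorem ex_Er_minimal_model:
  assumes d': "\<And>n x. x \<in> G n \<Longrightarrow> d' x = d x"
    and mu': "\<And>p q x y. x \<in> G p \<Longrightarrow> y \<in> G q \<Longrightarrow> mu' x y = mu x y"
  shows "\<exists>M nu f. Er_minimal_model scale G d' mu' F (int r) M nu f"
proof -
  \<comment> \<open>The bigrading of the model comes from a splitting of the filtration on
    \<open>V\<close>; \<open>W p n\<close> is placed in bidegree \<open>(p, n - p)\<close>.\<close>
  obtain W where W: "V.splitting W" using V.ex_splitting by blast
  have W_sub: "subspace (W p n)" for p n using W unfolding V.splitting_def by blast
  have W_V: "W p n \<subseteq> V p n" for p n by (rule V.splitting_subset[OF W])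
  define M where "M p q = W p (p + q)" for p q
  define nu where "nu s xs = bar.tbar (sgl xs)" for s :: nat and xs
  define f where "f s xs = bar.tmor (sgl xs)" for s :: nat and xs
  define MG where "MG n = span (\<Union>p. M p (n - p))" for n
  define FM where "FM p n = span (\<Union>p'\<in>{p..}. M p' (n - p'))" for p n
  have FM: "FM p n = V p n" for p n
    unfolding FM_def M_def using V.splitting_span[OF W] by simp
  have V_MG: "V p n \<subseteq> MG n" for p n
    unfolding FM[symmetric] FM_def MG_def by (intro span_mono) auto
  have MG_V: "\<exists>p. x \<in> V p n" if "x \<in> MG n" for x n
  proof -
    \<comment> \<open>The \<open>V p n\<close> are nested in \<open>p\<close>, so two elements
      always lie in a common member.\<close>
    have "subspace (\<Union>p. V p n)"
      unfolding subspace_def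
    proof (intro conjI ballI allI)
      show "0 \<in> (\<Union>p. V p n)" using subspace_0[OF V.F_subspace] by blast
      fix x assume "x \<in> (\<Union>p. V p n)"
      then obtain p where p: "x \<in> V p n" by blast
      then show "scale c x \<in> (\<Union>p. V p n)" for c using subspace_scale[OF V.F_subspace] by blast
      fix y assume "y \<in> (\<Union>p. V p n)"
      then obtain q where q: "y \<in> V q n" by blast
      have "x + y \<in> V (min p q) n"
        using p q V.F_antimono[of "min p q" p n] V.F_antimono[of "min p q" q n]
        by (intro subspace_add[OF V.F_subspace]) auto
      then show "x + y \<in> (\<Union>p. V p n)" by blast
    qed
    then have "MG n \<subseteq> (\<Union>p. V p n)"
      unfolding MG_def M_def using W_V by (intro span_minimal) auto
    then show ?thesis using that by blast
  qed
  have MG_G: "MG n \<subseteq> G n" for n using MG_V V_F F_G by blast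
  have hom_G: "homog G ns xs" if "homog MG ns xs" for ns xs
    using that MG_G unfolding homog_def by blast
  have nu_mult: "bar.multilinear (\<lambda>ys. bar.tbar (sgl ys))" "bar.multilinear (\<lambda>ys. bar.tmor (sgl ys))"
    using multilinear_sgl bar.multilinear_tbar bar.multilinear_tmor by blast+
  have nu_pm: "nu s xs = scale (ksign (reversal_sign ns)) (bar.tbar xs)"
    "f s xs = scale (ksign (reversal_sign ns)) (bar.tmor xs)" if "homog G ns xs" for s ns xs
    unfolding nu_def f_def
    using multilinear_sgl_G[OF bar.multilinear_tbar that] multilinear_sgl_G[OF bar.multilinear_tmor that] by auto
  have nu_1: "nu 1 [x] = d x" and f_1: "f 1 [x] = x" for x
    by (simp_all add: nu_def f_def)
  have nu_MG: "nu s xs \<in> MG (sum_list ns + 2 - int s)" if "s \<ge> 1" "length ns = s" "homog MG ns xs" for s ns xs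
  proof -
    have len: "length xs = s" using that homog_length by metis
    show ?thesis
    proof (cases "s = 1")
      case True
      then obtain x n where x: "xs = [x]" "ns = [n]"
        using True \<open>length ns = s\<close> len by (cases xs; cases ns) auto
      then have "x \<in> MG n" using that by (simp add: homog_Cons)
      then obtain p where "x \<in> V p n" using MG_V by blast
      then have "d x \<in> MG (n + 1)" using d_V V_MG by blast
      then show ?thesis using x True nu_1 by (simp add: add.commute)
    next
      case False
      obtain ps where "flist ps ns xs"
        using homog_flist[OF \<open>homog MG ns xs\<close>, of V] MG_V V_F by blast
      then have "bar.tbar xs \<in> MG (sum_list ns + 2 - int s)"
        using tbar_V[of ps ns xs] V_MG len False that by auto
      then show ?thesis
        unfolding nu_pm(1)[OF hom_G[OF that(3)]] MG_def by (rule span_scale)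
    qed
  qed
  have bihom: "flist ps (map2 (+) ps qs) xs \<and> sum_list (map2 (+) ps qs) = sum_list ps + sum_list qs \<and>
      homog G (map2 (+) ps qs) xs"
    if "length ps = s" "length qs = s" "length xs = s" "\<forall>i<s. xs ! i \<in> M (ps ! i) (qs ! i)" for s ps qs xs
  proof -
    have *: "xs ! i \<in> F (ps ! i) (ps ! i + qs ! i)" if "i < length xs" for i
      using that \<open>\<forall>i<s. _\<close> W_V V_F \<open>length xs = s\<close> unfolding M_def by blast
    have "sum_list (map2 (+) ps qs) = sum_list ps + sum_list qs"
      using that(1,2) by (induction ps arbitrary: qs s) (auto simp: length_Suc_conv)
    then show ?thesis
      using * subsetD[OF F_G *] that unfolding flist_def homog_def by auto
  qed
  have "Er_minimal_model scale G d' mu' F (int r) M nu f"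
    unfolding Er_minimal_model_def Let_def MG_def[symmetric, abs_def] FM_def[symmetric, abs_def]
  proof (intro conjI allI impI)
    show "subspace (M p q)" for p q unfolding M_def by (rule W_sub)
    show "direct_family (\<lambda>(p, q). M p q)"
      unfolding direct_family_def
    proof (intro allI impI ballI)
      fix I x i assume I: "finite I" "\<forall>i\<in>I. x i \<in> (case i of (p, q) \<Rightarrow> M p q)" "sum x I = 0" "i \<in> I"
      let ?g = "\<lambda>(p, q). (p, p + q)" and ?g' = "\<lambda>(p, n). (p, n - p)"
      have inv: "?g' (?g i) = i" for i :: "int \<times> int" by (cases i) simp
      have "x (?g' (?g i)) = 0"
      proof (rule direct_familyD[OF V.splitting_direct[OF W], of "?g ` I" "\<lambda>j. x (?g' j)" "?g i"])
        show "x (?g' j) \<in> (case j of (p, n) \<Rightarrow> W p n)" if "j \<in> ?g ` I" for j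
          using that I(2) by (auto simp: M_def)
        have "inj_on ?g I" by (auto simp: inj_on_def)
        then show "(\<Sum>j\<in>?g ` I. x (?g' j)) = 0"
          using I(3) by (simp add: sum.reindex inv)
      qed (use I in auto)
      then show "x i = 0" by (simp add: inv)
    qed
    show "ainf_alg scale MG nu"
      unfolding ainf_alg_def
    proof (intro conjI allI impI)
      show "graded_vs scale MG"
        unfolding graded_vs_def
        using direct_family_mono[OF F_direct, of MG] MG_G vector_space_axioms
        by (auto simp: MG_def G_eq intro: subspace_span)
      show "multilin_on scale (tot scale MG) s (nu s)" for s
        unfolding multilin_on_def lin_on_def nu_def using multilinear_update[OF nu_mult(1)] by blast
      show "nu s xs \<in> MG (sum_list ns + 2 - int s)" if "1 \<le> s" "length ns = s" "homog MG ns xs" for s ns xs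
        by (rule nu_MG[OF that])
      show "insert_op_sum scale nu nu scale ns xs = 0" if "homog MG ns xs" for ns xs
        unfolding nu_def[abs_def] insert_op_sum_sgl[OF bar.multilinear_tbar hom_G[OF that]]
        by (simp add: bar.bar_insert_tbar)
    qed
    show "nu 1 [x] \<in> span (\<Union>k::nat. M (p + int r + int k + 1) (q - int r - int k))" if "x \<in> M p q" for p q x
    proof -
      have "d x \<in> V (p + int r + 1) (p + q + 1)"
        using that d_V W_V unfolding M_def by blast
      also have "V (p + int r + 1) (p + q + 1) = span (\<Union>p'\<in>{p + int r + 1..}. W p' (p + q + 1))"
        using V.splitting_span[OF W] by simp
      \<comment> \<open>The indices \<open>p' \<ge> p + r + 1\<close> are parametrized by
        \<open>k = p' - (p + r + 1)\<close>; the total degree then determines the second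
        index.\<close>
      also have "\<dots> = span (\<Union>k::nat. M (p + int r + int k + 1) (q - int r - int k))"
      proof (rule arg_cong[where f=span])
        have "{p + int r + 1..} = range (\<lambda>k::nat. p + int r + int k + 1)"
          by (auto intro!: image_eqI[of _ _ "nat (_ - (p + int r + 1))"])
        then show "(\<Union>p'\<in>{p + int r + 1..}. W p' (p + q + 1)) = (\<Union>k::nat. M (p + int r + int k + 1) (q - int r - int k))"
          by (simp add: M_def algebra_simps)
      qed
      finally show ?thesis unfolding nu_1 .
    qed
    show "nu s xs \<in> span (\<Union>k::nat. M (sum_list ps + (2 - int s) * int r + int k)
             (sum_list qs + (2 - int s) * (1 - int r) - int k))"
      if "2 \<le> s" "length ps = s" "length qs = s" "length xs = s" "\<forall>i<s. xs ! i \<in> M (ps ! i) (qs ! i)"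
      for s ps qs xs
    proof -
      let ?p = "sum_list ps + (2 - int s) * int r" and ?n = "sum_list ps + sum_list qs + 2 - int s"
      have b: "flist ps (map2 (+) ps qs) xs" "sum_list (map2 (+) ps qs) = sum_list ps + sum_list qs"
        "homog G (map2 (+) ps qs) xs" using bihom[OF that(2-5)] by auto
      have "nu s xs \<in> V ?p ?n"
        unfolding nu_pm(1)[OF b(3)] using tbar_V[OF b(1)] that(1,4) b(2)
        by (intro subspace_scale[OF V.F_subspace]) simp
      also have "V ?p ?n = span (\<Union>p'\<in>{?p..}. W p' ?n)"
        using V.splitting_span[OF W] by simp
      also have "\<dots> = span (\<Union>k::nat. M (?p + int k) (sum_list qs + (2 - int s) * (1 - int r) - int k))"
      proof (rule arg_cong[where f=span])
        have "{?p..} = range (\<lambda>k::nat. ?p + int k)"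
          by (auto intro!: image_eqI[of _ _ "nat (_ - ?p)"])
        moreover have "?p + int k + (sum_list qs + (2 - int s) * (1 - int r) - int k) = ?n" for k :: nat
          by (simp add: algebra_simps)
        ultimately show "(\<Union>p'\<in>{?p..}. W p' ?n) = (\<Union>k::nat. M (?p + int k) (sum_list qs + (2 - int s) * (1 - int r) - int k))"
          by (simp only: M_def image_image)
      qed
      finally show ?thesis .
    qed
    show "ainf_morph scale MG nu scale G (dga_ainf d' mu') f"
      unfolding ainf_morph_def
    proof (intro conjI allI impI)
      show "f s (xs[i := scale c u + v]) = scale c (f s (xs[i := u])) + f s (xs[i := v])"
        if "length xs = s" "i < s" for s xs i c u v
        unfolding f_def using multilinear_update[OF nu_mult(2)] that by blast
      show "f s xs \<in> G (sum_list ns + 1 - int s)" if "1 \<le> s" "length ns = s" "homog MG ns xs" for s ns xs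
      proof -
        have "xs \<noteq> []" using that homog_length by fastforce
        then have "bar.tmor xs \<in> G (sum_list ns + 1 - int s)"
          using tmor_G[OF hom_G[OF that(3)]] homog_length[OF that(3)] that(2) by simp
        then show ?thesis
          unfolding nu_pm(2)[OF hom_G[OF that(3)]] by (rule subspace_scale[OF G_subspace])
      qed
      show "insert_op_sum scale f nu scale ns xs = comp_sum scale (dga_ainf d' mu') f ns xs"
        if "1 \<le> length ns" "homog MG ns xs" for ns xs
      proof -
        have ne: "xs \<noteq> []" using that homog_length by fastforce
        show ?thesis
          unfolding f_def[abs_def] nu_def[abs_def] insert_op_sum_sgl[OF bar.multilinear_tmor hom_G[OF that(2)]]
          by (simp add: comp_sum_sgl[OF hom_G[OF that(2)] ne d' mu'] bar.bar_insert_tmor)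
      qed
    qed
    show "f s xs \<in> F (sum_list ps + (1 - int s) * int r) (sum_list ps + sum_list qs - int s + 1)"
      if "1 \<le> s" "length ps = s" "length qs = s" "length xs = s" "\<forall>i<s. xs ! i \<in> M (ps ! i) (qs ! i)"
      for s ps qs xs
    proof -
      have b: "flist ps (map2 (+) ps qs) xs" "sum_list (map2 (+) ps qs) = sum_list ps + sum_list qs"
        "homog G (map2 (+) ps qs) xs" using bihom[OF that(2-5)] by auto
      have ne: "xs \<noteq> []" using that by auto
      have "bar.tmor xs \<in> F (sum_list ps + (1 - int s) * int r) (sum_list ps + sum_list qs - int s + 1)"
        using tmor_tprod_F[OF b(1) ne] b(2) that(4) by (simp add: algebra_simps)
      then show ?thesis
        unfolding nu_pm(2)[OF b(3)] by (rule subspace_scale[OF F_subspace])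
    qed
    show "Er_quasi_iso (\<lambda>x. nu 1 [x]) FM d' F (\<lambda>x. f 1 [x]) (int r)"
    proof -
      have dF: "d' x = d x" if "x \<in> F p n" for x p n using d' F_G that by blast
      then have "Er_quasi_iso d V d' F (\<lambda>x. x) (int r)"
        using Er_quasi_iso_V Er_quasi_iso_cong[of d'] by blast
      moreover have "(\<lambda>x. nu 1 [x]) = d" "(\<lambda>x. f 1 [x]) = (\<lambda>x. x)" "FM = V"
        using nu_1 f_1 FM by (intro ext; simp)+
      ultimately show ?thesis by (simp only:)
    qed
  qed
  then show ?thesis by blast
qed

end


theorem theorem3p16:
  fixes scale :: "'k::field \<Rightarrow> 'a::ab_group_add \<Rightarrow> 'a"
    and G :: "int \<Rightarrow> 'a set" and d :: "'a \<Rightarrow> 'a" and mu :: "'a \<Rightarrow> 'a \<Rightarrow> 'a"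
    and F :: "int \<Rightarrow> int \<Rightarrow> 'a set" and r :: nat
  assumes "filtered_dga scale G d mu F"
  shows "\<exists>M nu f. Er_minimal_model scale G d mu F (int r) M nu f"
proof -
  have dga: "dga scale G d mu" using assms unfolding filtered_dga_def by blast
  then have vs: "vector_space scale" unfolding dga_def graded_vs_def by blast
  interpret linear_space scale by (rule linear_space.intro[OF vs])
  interpret endo: vector_space_pair scale scale by unfold_locales
  let ?T = "tot scale G"
  have T_sub: "subspace ?T" unfolding tot_def by (rule subspace_span)
  have G_T: "x \<in> ?T" if "x \<in> G n" for x n
    using that unfolding tot_def by (intro span_base) blast
  have G_sub: "subspace (G n)" and G_dir: "direct_family G" for n
    using dga unfolding dga_def graded_vs_def by blast+
  have d_on: "lin_on scale ?T d" and d_G: "x \<in> G n \<Longrightarrow> d x \<in> G (n + 1)"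
    and d_d: "x \<in> ?T \<Longrightarrow> d (d x) = 0"
    and mu_on: "x \<in> ?T \<Longrightarrow> lin_on scale ?T (mu x)" "y \<in> ?T \<Longrightarrow> lin_on scale ?T (\<lambda>x. mu x y)"
    and mu_G: "x \<in> G p \<Longrightarrow> y \<in> G q \<Longrightarrow> mu x y \<in> G (p + q)"
    and assoc: "x \<in> ?T \<Longrightarrow> y \<in> ?T \<Longrightarrow> z \<in> ?T \<Longrightarrow> mu (mu x y) z = mu x (mu y z)"
    and leib: "x \<in> G p \<Longrightarrow> y \<in> ?T \<Longrightarrow> d (mu x y) = mu (d x) y + scale (ksign p) (mu x (d y))"
    for x y z n p q
    using dga unfolding dga_def by simp_all
  have F_sub: "subspace (F p n)" and F_G: "F p n \<subseteq> G n" and F_dec: "F (p + 1) n \<subseteq> F p n"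
    and F_bd: "\<exists>l. F l n = {0}" and F_ex: "(\<Union>p. F p n) = G n"
    and d_F: "d ` F p n \<subseteq> F p (n + 1)"
    and mu_F: "x \<in> F p i \<Longrightarrow> y \<in> F q j \<Longrightarrow> mu x y \<in> F (p + q) (i + j)" for p q n i j x y
    using assms unfolding filtered_dga_def by simp_all
  obtain \<pi> where \<pi>_T: "range \<pi> \<subseteq> ?T" and \<pi>_lin: "lin \<pi>" and \<pi>_id: "\<And>x. x \<in> ?T \<Longrightarrow> \<pi> x = x"
    using ex_projection[OF T_sub] by blast
  have \<pi>_in: "\<pi> x \<in> ?T" for x using \<pi>_T by blast
  note lin = lin_iff[THEN iffD1, rule_format]
  have eq_on_T: "f x = g x" if "lin f" "lin g" "\<And>n x. x \<in> G n \<Longrightarrow> f x = g x" "x \<in> ?T" for f g x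
    by (rule endo.linear_eq_on[OF that(1,2) that(4)[unfolded tot_def]]) (use that(3) in blast)
  have maps_T: "f x \<in> ?T" if "lin f" "\<And>n x. x \<in> G n \<Longrightarrow> f x \<in> ?T" "x \<in> ?T" for f x
  proof -
    have "?T \<subseteq> {x. f x \<in> ?T}"
      unfolding tot_def
      by (rule span_minimal) (use that(2) endo.linear_subspace_linear_preimage[OF that(1) T_sub] in \<open>auto simp: tot_def\<close>)
    then show ?thesis using that(3) by blast
  qed

  text \<open>Precomposing with a projection onto the total space makes all structure maps globally linear.\<close>
  define D where "D x = d (\<pi> x)" for x
  define mm where "mm x y = mu (\<pi> x) (\<pi> y)" for x y
  have D_lin: "lin D"
    using d_on \<pi>_in by (simp add: lin_iff D_def lin[OF \<pi>_lin] lin_on_def)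
  have mm_l: "lin (\<lambda>x. mm x y)" and mm_r: "lin (mm x)" for x y
    using mu_on \<pi>_in by (simp_all add: lin_iff mm_def lin[OF \<pi>_lin] lin_on_def)
  have D_G: "D x = d x" if "x \<in> G n" for x n
    by (simp add: D_def \<pi>_id[OF G_T[OF that]])
  have mm_G: "mm x y = mu x y" if "x \<in> G p" "y \<in> G q" for x y p q
    by (simp add: mm_def \<pi>_id[OF G_T[OF that(1)]] \<pi>_id[OF G_T[OF that(2)]])
  have D_T: "D x \<in> ?T" for x
  proof -
    have "D (\<pi> x) \<in> ?T"
      by (rule maps_T[OF D_lin _ \<pi>_in]) (use D_G d_G G_T in metis)
    then show ?thesis by (simp add: D_def \<pi>_id \<pi>_in)
  qed
  have D_\<pi>: "D (\<pi> x) = D x" for x by (simp add: D_def \<pi>_id[OF \<pi>_in])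
  have mm_\<pi>: "mm (\<pi> x) y = mm x y" "mm x (\<pi> y) = mm x y" for x y
    by (simp_all add: mm_def \<pi>_id[OF \<pi>_in])
  have D_D: "D (D x) = 0" for x
    using d_d[OF \<pi>_in, of x] \<pi>_id[OF D_T, of x] by (simp add: D_def)
  have mm_T1: "mm x y \<in> ?T" if "y \<in> G q" for x y q
  proof -
    have "mm (\<pi> x) y \<in> ?T"
      by (rule maps_T[OF mm_l _ \<pi>_in]) (use mm_G mu_G G_T that in metis)
    then show ?thesis by (simp add: mm_\<pi>)
  qed
  have mm_T: "mm x y \<in> ?T" for x y
  proof -
    have "mm x (\<pi> y) \<in> ?T"
      by (rule maps_T[OF mm_r _ \<pi>_in]) (rule mm_T1)
    then show ?thesis by (simp add: mm_\<pi>)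
  qed
  have mm_assoc: "mm (mm x y) z = mm x (mm y z)" for x y z
    using assoc[OF \<pi>_in \<pi>_in \<pi>_in, of x y z] \<pi>_id[OF mm_T, of x y] \<pi>_id[OF mm_T, of y z]
    by (simp add: mm_def)

  have "\<exists>h. lin h \<and> (\<forall>n. \<forall>x\<in>G n. h x = scale (ksign n) x)"
    by (rule ex_linear_on_direct_family[OF G_dir G_sub])
       (simp add: lin_iff scale_right_distrib mult.commute)
  then obtain s where s_lin: "lin s" and s_G: "\<And>n x. x \<in> G n \<Longrightarrow> s x = scale (ksign n) x" by blast
  \<comment> \<open>On the kernel of \<open>\<pi>\<close> the identity is taken, so that
    \<open>sg\<close> is an involution of the whole type and commutes with
    \<open>\<pi>\<close>.\<close>
  define sg where "sg x = s (\<pi> x) + (x - \<pi> x)" for x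
  have sg_lin: "lin sg"
    using lin_add[OF lin_compose[OF s_lin \<pi>_lin] lin_diff[OF lin_ident \<pi>_lin]] by (simp add: sg_def[abs_def])
  have s_T: "s x \<in> ?T" if "x \<in> ?T" for x
    by (rule maps_T[OF s_lin _ that]) (use s_G G_T subspace_scale[OF G_sub] in metis)
  have sg_T: "sg x = s x" if "x \<in> ?T" for x using \<pi>_id[OF that] by (simp add: sg_def)
  have sg_G: "sg x = scale (ksign n) x" if "x \<in> G n" for x n
    using sg_T[OF G_T[OF that]] s_G[OF that] by simp
  have \<pi>_sg: "\<pi> (sg x) = sg (\<pi> x)" for x
    using \<pi>_id[OF s_T[OF \<pi>_in]] \<pi>_id[OF \<pi>_in] sg_T[OF \<pi>_in]
    by (simp add: sg_def endo.linear_add[OF \<pi>_lin] endo.linear_diff[OF \<pi>_lin])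
  have ksign_sq: "ksign n * ksign n = (1::'k)" for n by (simp add: ksign_def)
  have s_s: "s (s x) = x" if "x \<in> ?T" for x
    by (rule eq_on_T[OF lin_compose[OF s_lin s_lin] lin_ident _ that])
       (simp add: s_G endo.linear_scale[OF s_lin] ksign_sq)
  have sg_sg: "sg (sg x) = x" for x
  proof -
    have "sg (sg x) = s (s (\<pi> x)) + (sg x - s (\<pi> x))"
      unfolding sg_def[of "sg x"] \<pi>_sg sg_T[OF \<pi>_in] ..
    then show ?thesis by (simp add: s_s[OF \<pi>_in] sg_def)
  qed
  \<comment> \<open>Applied to \<open>D\<close> and \<open>h\<close>, of degrees 1 and -1. Factoring
    through \<open>\<pi>\<close> reduces the claim to the total space, and linearity then reduces it
    to homogeneous elements.\<close>
  have anti: "g (sg x) = - sg (g x)"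
    if g: "lin g" "\<And>x. g (\<pi> x) = g x" "\<And>n x. x \<in> G n \<Longrightarrow> \<exists>k. odd (k - n) \<and> g x \<in> G k" for g x
  proof -
    have neg: "lin (\<lambda>x. - sg (g x))"
      by (simp add: lin_iff lin[OF sg_lin] lin[OF g(1)])
    have "g (sg (\<pi> x)) = - sg (g (\<pi> x))"
    proof (rule eq_on_T[OF lin_compose[OF g(1) sg_lin] neg _ \<pi>_in])
      fix n x assume x: "x \<in> G n"
      then obtain k where "odd (k - n)" "g x \<in> G k" using g(3) by blast
      then show "g (sg x) = - sg (g x)"
        by (auto simp: sg_G[OF x] sg_G endo.linear_scale[OF g(1)] ksign_def)
    qed
    then show ?thesis using g(2)[of "sg x"] g(2)[of x] \<pi>_sg[of x] by simp
  qed
  have D_sg: "D (sg x) = - sg (D x)" for x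
  proof (rule anti[OF D_lin D_\<pi>])
    fix n x assume "x \<in> G n"
    then show "\<exists>k. odd (k - n) \<and> D x \<in> G k" using D_G[of x n] d_G[of x n] by (intro exI[of _ "n + 1"]) simp
  qed
  have sg_mm: "sg (mm x y) = mm (sg x) (sg y)" for x y
  proof -
    have 1: "sg (mm x y) = mm (sg x) (sg y)" if y: "y \<in> G q" and "x \<in> ?T" for x y q
    proof (rule eq_on_T[OF lin_compose[OF sg_lin mm_l] lin_compose[OF mm_l sg_lin] _ \<open>x \<in> ?T\<close>])
      fix p x assume x: "x \<in> G p"
      then show "sg (mm x y) = mm (sg x) (sg y)"
        using mm_G[OF x y] mu_G[OF x y]
        by (simp add: sg_G[OF x] sg_G[OF y] sg_G ksign_add endo.linear_scale[OF mm_l] endo.linear_scale[OF mm_r])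
    qed
    have "sg (mm (\<pi> x) (\<pi> y)) = mm (sg (\<pi> x)) (sg (\<pi> y))"
      by (rule eq_on_T[OF lin_compose[OF sg_lin mm_r] lin_compose[OF mm_r sg_lin] _ \<pi>_in]) (rule 1[OF _ \<pi>_in])
    then show ?thesis by (simp only: mm_\<pi> \<pi>_sg[symmetric])
  qed
  have D_mm: "D (mm x y) = mm (D x) y + mm (sg x) (D y)" for x y
  proof -
    have "D (mm (\<pi> x) y) = mm (D (\<pi> x)) y + mm (sg (\<pi> x)) (D y)"
    proof (rule eq_on_T[OF lin_compose[OF D_lin mm_l]
          lin_add[OF lin_compose[OF mm_l D_lin] lin_compose[OF mm_l sg_lin]] _ \<pi>_in])
      fix p x assume x: "x \<in> G p"
      have "mm x y = mu x (\<pi> y)" by (simp add: mm_def \<pi>_id[OF G_T[OF x]])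
      then have "D (mm x y) = d (mu x (\<pi> y))" using \<pi>_id[OF mm_T, of x y] by (simp add: D_def)
      also have "\<dots> = mu (d x) (\<pi> y) + scale (ksign p) (mu x (d (\<pi> y)))"
        by (rule leib[OF x \<pi>_in])
      also have "mu (d x) (\<pi> y) = mm (D x) y"
        using G_T[OF d_G[OF x]] by (simp add: mm_def D_G[OF x] \<pi>_id)
      also have "mu x (d (\<pi> y)) = mm x (D y)"
        using \<pi>_id[OF D_T, of y] by (simp add: mm_def \<pi>_id[OF G_T[OF x]] D_def)
      finally show "D (mm x y) = mm (D x) y + mm (sg x) (D y)"
        by (simp add: sg_G[OF x] endo.linear_scale[OF mm_l])
    qed
    then show ?thesis by (simp only: mm_\<pi> D_\<pi> \<pi>_sg[symmetric])
  qed

  have fc: "filtered_complex scale F D"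
  proof (intro filtered_complex.intro filtered_space.intro linear_space_axioms
      filtered_space_axioms.intro filtered_complex_axioms.intro F_sub F_dec F_bd D_lin D_D)
    show "direct_family (\<lambda>n. \<Union>p. F p n)" unfolding F_ex by (rule G_dir)
    show "D x \<in> F p (n + 1)" if "x \<in> F p n" for x p n
      using D_G[of x n] that F_G d_F by (metis image_subset_iff subsetD)
  qed
  then interpret C: filtered_complex scale F D .
  obtain h0 where h0: "C.contraction (int r) h0" using C.ex_contraction by blast
  \<comment> \<open>Composing with \<open>\<pi>\<close> leaves \<open>h0\<close> unchanged on the
    filtration and makes it factor through \<open>\<pi>\<close>, as \<open>anti\<close>
    requires.\<close>
  define h where "h x = h0 (\<pi> x)" for x
  have h0_lin: "lin h0" using h0 unfolding C.contraction_def by blast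
  have h_lin: "lin h" using lin_compose[OF h0_lin \<pi>_lin] by (simp add: h_def[abs_def])
  have h_h0: "h x = h0 x" if "x \<in> F p n" for x p n
    using that F_G G_T by (metis \<pi>_id h_def subsetD)
  have proj: "homotopy_proj D h x = homotopy_proj D h0 x" if "x \<in> F p n" for x p n
    using h_h0[OF that] h_h0[OF C.d_F[OF that]] by (simp add: homotopy_proj_def)
  have h: "C.contraction (int r) h"
    unfolding C.contraction_def
  proof (intro conjI allI ballI h_lin)
    fix p n x assume x: "x \<in> F p n"
    have *: "h0 x \<in> F (p - int r) (n - 1)" "homotopy_proj D h0 x \<in> F p n"
     "D (homotopy_proj D h0 x) \<in> F (p + int r + 1) (n + 1)" "h0 (homotopy_proj D h0 x) = 0"
      using h0 x unfolding C.contraction_def by blast+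
    show "h x \<in> F (p - int r) (n - 1)" using * h_h0[OF x] by simp
    show "homotopy_proj D h x \<in> F p n" "D (homotopy_proj D h x) \<in> F (p + int r + 1) (n + 1)"
      using * proj[OF x] by simp_all
    show "h (homotopy_proj D h x) = 0" using * proj[OF x] h_h0[OF *(2)] by simp
  qed
  have h_sg: "h (sg x) = - sg (h x)" for x
  proof (rule anti[OF h_lin])
    show "h (\<pi> x) = h x" for x by (simp add: h_def \<pi>_id[OF \<pi>_in])
    fix n x assume "x \<in> G n"
    then obtain p where "x \<in> F p n" using F_ex by blast
    then have "h x \<in> G (n - 1)" using h F_G unfolding C.contraction_def by blast
    then show "\<exists>k. odd (k - n) \<and> h x \<in> G k" by (intro exI[of _ "n - 1"]) simp
  qed
  interpret filtered_transfer scale F D G mm sg h r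
  proof (intro filtered_transfer.intro fc filtered_transfer_axioms.intro)
    show "mm x y \<in> F (p + q) (i + j)" if "x \<in> F p i" "y \<in> F q j" for x y p q i j
      using that mu_F mm_G F_G by (metis subsetD)
  qed (fact F_ex[symmetric] G_sub sg_lin sg_sg sg_G D_sg h_sg mm_l mm_r sg_mm D_mm mm_assoc h)+
  show ?thesis
    by (rule ex_Er_minimal_model) (use D_G mm_G in auto)
qed

end
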